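(* Let $(X,x_0)$ be a pointed space, $C(X)$ the cone over $X$, and $\hat{x}_t=(x_0,t)\in C(X)$ with $t\neq1$. Then $$\mathcal{H}_\infty(C(X),\hat{x}_t)\cong\frac{\mathcal{H}_\infty(X,x_0)}{\prod^w_{n\in\mathbb{N}}\prod^w_{k\in\mathbb{N}}\pi_n(X,x_0)},$$ where $\prod^w_{n\in\mathbb{N}}\prod^w_{k\in\mathbb{N}}\pi_n(X,x_0)$ is regarded as a subgroup of $\mathcal{H}_\infty(X,x_0)$ via the monomorphism sending a family $([f_{n,k}])_{n,k}$ (with $f_{n,k}:(S^n_k,\theta)\to(X,x_0)$, only finitely many $n$ having a nontrivial entry and, for each $n$, only finitely many $k$ with $[f_{n,k}]$ nontrivial, the trivial entries represented by constant maps) to the class of the map $f:\mathbb{H}^\infty\to X$ with $f|_{S^n_k}=f_{n,k}$ for all $n,k$.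
   Context: The cone is $C(X)=X\times[0,1]/X\times\{1\}$. For $n\geq1$, $\mathbb{H}^n=\{(r_0,\dots,r_n)\in\mathbb{R}^{n+1} : (r_0-1/k)^2+\sum_{i=1}^n r_i^2=(1/k)^2 \text{ for some } k\in\mathbb{N}\}$ is the $n$-dimensional Hawaiian earring with base point $\theta$ (the origin); $S^n_k$ is its sphere of radius $1/k$. $\mathbb{H}^\infty$ is the weak join of $\{(\mathbb{H}^n,\theta)\}_{n\in\mathbb{N}}$: the disjoint union with all base points identified to $\theta$, where $U$ is open iff $U\cap\mathbb{H}^n$ is open in $\mathbb{H}^n$ for all $n$ and, if $\theta\in U$, then $\mathbb{H}^n\subseteq U$ for all but finitely many $n$. For a pointed space $(Y,y)$, $\mathcal{H}_\infty(Y,y)$ is the set of pointed homotopy classes (rel $\{\theta\}$) of continuous maps $(\mathbb{H}^\infty,\theta)\to(Y,y)$, with group operation $[f][g]=[f\ast g]$ where on each sphere $S^n_k\subseteq\mathbb{H}^n$, $(f\ast g)|_{S^n_k}$ is the usual $\pi_n$-concatenation of $f|_{S^n_k}$ and $g|_{S^n_k}$. $\prod^w$ denotes the weak direct product (families with all but finitely many entries trivial). *)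

theory Defs
  imports "HOL-Analysis.Analysis" "HOL-Algebra.Coset"
begin

definition quotient_topology :: "'a topology \<Rightarrow> ('a \<Rightarrow> 'b) \<Rightarrow> 'b topology" where
  "quotient_topology T q =
     topology (\<lambda>U. U \<subseteq> q ` topspace T \<and> openin T {x \<in> topspace T. q x \<in> U})"

definition cone_quot :: "'a \<times> real \<Rightarrow> ('a \<times> real) option" where
  "cone_quot p = (if snd p = 1 then None else Some p)"

definition cone :: "'a topology \<Rightarrow> ('a \<times> real) option topology" where
  "cone X = quotient_topology (prod_topology X (top_of_set {0..1})) cone_quot"

definition cone_pt :: "'a \<Rightarrow> real \<Rightarrow> ('a \<times> real) option" where
  "cone_pt x t = cone_quot (x, t)"

(* Points of R^{n+1} are functions nat \<Rightarrow> real vanishing beyond index n. *)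
definition hsphere :: "nat \<Rightarrow> nat \<Rightarrow> (nat \<Rightarrow> real) set" where
  "hsphere n k = {r. (\<forall>i>n. r i = 0) \<and>
      (r 0 - 1 / real k)\<^sup>2 + (\<Sum>i\<in>{1..n}. (r i)\<^sup>2) = (1 / real k)\<^sup>2}"

definition hawaiian :: "nat \<Rightarrow> (nat \<Rightarrow> real) set" where
  "hawaiian n = (\<Union>k\<in>{1..}. hsphere n k)"

definition hawaiian_top :: "nat \<Rightarrow> (nat \<Rightarrow> real) topology" where
  "hawaiian_top n = top_of_set (hawaiian n)"

(* Weak join H^\<infinity>: points (n, r) with r \<in> H^n - {0}, base point \<theta> = (0, 0). *)
definition origin :: "nat \<Rightarrow> real" where
  "origin = (\<lambda>_. 0)"

definition hbase :: "nat \<times> (nat \<Rightarrow> real)" where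
  "hbase = (0, origin)"

definition hemb :: "nat \<Rightarrow> (nat \<Rightarrow> real) \<Rightarrow> nat \<times> (nat \<Rightarrow> real)" where
  "hemb n r = (if r = origin then hbase else (n, r))"

definition hinf_set :: "(nat \<times> (nat \<Rightarrow> real)) set" where
  "hinf_set = (\<Union>n\<in>{1..}. hemb n ` hawaiian n)"

definition hinf_top :: "(nat \<times> (nat \<Rightarrow> real)) topology" where
  "hinf_top = topology (\<lambda>U. U \<subseteq> hinf_set
      \<and> (\<forall>n\<ge>1. openin (hawaiian_top n) {r \<in> hawaiian n. hemb n r \<in> U})
      \<and> (hbase \<in> U \<longrightarrow> finite {n. n \<ge> 1 \<and> \<not> hemb n ` hawaiian n \<subseteq> U}))"

(* Identification I^n / \<partial>I^n \<cong> S^n_k used for the usual \<pi>_n-concatenation: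
   cube coordinates are indexed 1..n; the interior is sent homeomorphically onto
   S^n_k - {\<theta>} (coordinatewise tan, then inverse stereographic projection from \<theta>),
   and the boundary goes to \<theta>. *)
definition open_cube :: "nat \<Rightarrow> (nat \<Rightarrow> real) set" where
  "open_cube n = {s. (\<forall>i. 1 \<le> i \<and> i \<le> n \<longrightarrow> 0 < s i \<and> s i < 1) \<and>
                     (\<forall>i. \<not> (1 \<le> i \<and> i \<le> n) \<longrightarrow> s i = 0)}"

definition cube_to_sphere :: "nat \<Rightarrow> nat \<Rightarrow> (nat \<Rightarrow> real) \<Rightarrow> (nat \<Rightarrow> real)" where
  "cube_to_sphere n k s =
     (if s \<notin> open_cube n then origin else
      (let u = (\<lambda>i. tan (pi * (s i - 1/2)));
           N = (\<Sum>i\<in>{1..n}. (u i)\<^sup>2)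
       in (\<lambda>i. if i = 0 then (2 / real k) / (1 + N)
               else if i \<le> n then (1 / real k) * (2 * u i) / (1 + N)
               else 0)))"

definition sphere_concat ::
  "nat \<Rightarrow> nat \<Rightarrow> ((nat \<Rightarrow> real) \<Rightarrow> 'b) \<Rightarrow> ((nat \<Rightarrow> real) \<Rightarrow> 'b) \<Rightarrow> (nat \<Rightarrow> real) \<Rightarrow> 'b" where
  "sphere_concat n k f g x =
     (if x \<in> hsphere n k \<and> x \<noteq> origin then
        (let s = (THE s. s \<in> open_cube n \<and> cube_to_sphere n k s = x)
         in if s 1 \<le> 1/2 then f (cube_to_sphere n k (s(1 := 2 * s 1)))
            else g (cube_to_sphere n k (s(1 := 2 * s 1 - 1))))
      else f x)"

definition sphere_index :: "nat \<Rightarrow> (nat \<Rightarrow> real) \<Rightarrow> nat" where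
  "sphere_index n r = (THE k. k \<ge> 1 \<and> r \<in> hsphere n k)"

definition hinf_mult ::
  "(nat \<times> (nat \<Rightarrow> real) \<Rightarrow> 'b) \<Rightarrow> (nat \<times> (nat \<Rightarrow> real) \<Rightarrow> 'b) \<Rightarrow> nat \<times> (nat \<Rightarrow> real) \<Rightarrow> 'b" where
  "hinf_mult f g p =
     (if p = hbase then f hbase
      else sphere_concat (fst p) (sphere_index (fst p) (snd p))
             (\<lambda>x. f (hemb (fst p) x)) (\<lambda>x. g (hemb (fst p) x)) (snd p))"

definition based_maps :: "'b topology \<Rightarrow> 'b \<Rightarrow> (nat \<times> (nat \<Rightarrow> real) \<Rightarrow> 'b) set" where
  "based_maps Y y = {f. continuous_map hinf_top Y f \<and> f hbase = y}"

definition hclass ::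
  "'b topology \<Rightarrow> 'b \<Rightarrow> (nat \<times> (nat \<Rightarrow> real) \<Rightarrow> 'b) \<Rightarrow> (nat \<times> (nat \<Rightarrow> real) \<Rightarrow> 'b) set" where
  "hclass Y y f = {g \<in> based_maps Y y. homotopic_with (\<lambda>h. h hbase = y) hinf_top Y f g}"

definition Hinf_group :: "'b topology \<Rightarrow> 'b \<Rightarrow> (nat \<times> (nat \<Rightarrow> real) \<Rightarrow> 'b) set monoid" where
  "Hinf_group Y y =
     \<lparr>carrier = hclass Y y ` based_maps Y y,
      monoid.mult = (\<lambda>A B. hclass Y y (hinf_mult (SOME f. f \<in> A) (SOME g. g \<in> B))),
      one = hclass Y y (\<lambda>_. y)\<rparr>"

definition sphere_null ::
  "'b topology \<Rightarrow> 'b \<Rightarrow> nat \<Rightarrow> nat \<Rightarrow> (nat \<times> (nat \<Rightarrow> real) \<Rightarrow> 'b) \<Rightarrow> bool" where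
  "sphere_null Y y n k f =
     homotopic_with (\<lambda>h. h origin = y) (top_of_set (hsphere n k)) Y (\<lambda>r. f (hemb n r)) (\<lambda>_. y)"

(* image of the weak product \<Prod>^w_n \<Prod>^w_k \<pi>_n(Y,y) under the monomorphism:
   classes of maps whose restrictions to the spheres S^n_k form a finitely supported
   family, with the trivial entries represented by constant maps *)
definition wprod_image :: "'b topology \<Rightarrow> 'b \<Rightarrow> (nat \<times> (nat \<Rightarrow> real) \<Rightarrow> 'b) set set" where
  "wprod_image Y y = hclass Y y ` {f \<in> based_maps Y y.
      (\<forall>n\<ge>1. \<forall>k\<ge>1. sphere_null Y y n k f \<longrightarrow> (\<forall>r\<in>hsphere n k. f (hemb n r) = y))
      \<and> finite {(n, k). n \<ge> 1 \<and> k \<ge> 1 \<and> \<not> sphere_null Y y n k f}}"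

end

(* Neighbourhoods of the base point contain all but finitely many spheres, so a based map on
   the weak join is a family of based maps on the cubes I^n, indexed by (n, k), that is null:
   every neighbourhood of y contains the images of all but finitely many members.  Homotopies
   are such families too, because [0, 1] is compact.

   The inclusion of X into C(X) at height t induces a homomorphism between the two groups.
   It is onto: a based map into C(X) avoids the apex on all but finitely many spheres, each of
   the remaining ones is null-homotopic because C(X) is contractible, and away from the apex the
   height can be moved linearly to t.  Its kernel is the weak product: a finitely supported map
   dies in C(X), and conversely a null homotopy in C(X) avoids the apex on all but finitely many
   spheres and projects there to a null homotopy in X. *)
theory Submission
  imports Defs
begin

section \<open>Spheres and cubes\<close>


text \<open>The contraction of C(X) to its apex moves the base point, and the null homotopies of
  spheres built from it pass through the apex however small the sphere is. So they cannot be
  performed on infinitely many spheres at once, and this is why only finitely supported classes die.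
  Away from the apex, on the other hand, the cone is the product of X with [0, 1), so no local
  condition on X enters: only the height has to be straightened, and the base point stays fixed
  because its height is t at both ends.

  Cubes are used because the multiplication is a change of the first cube coordinate. A cube
  representative is extended by the base value beyond the cube, to all of
  \<open>coord_space n\<close>; a parameter may then run out of the cube, and each group law becomes
  a choice of one real function. Normality of the weak product is not checked by conjugation but
  read off from its being a kernel.\<close>

lemma origin_in_hsphere [simp]: "origin \<in> hsphere n k"
  by (simp add: hsphere_def origin_def)

text \<open>Expanding the square leaves \<open>k\<close> only in the coefficient
  \<open>2 / real k\<close>, so it can be read off any point with \<open>r 0 > 0\<close>. This form
  also fits the stereographic formulas.\<close>

lemma hsphere_iff:
  "r \<in> hsphere n k \<longleftrightarrow> (\<forall>i>n. r i = 0) \<and> (r 0)\<^sup>2 + (\<Sum>i\<in>{1..n}. (r i)\<^sup>2) = (2 / real k) * r 0"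
proof -
  have "(r 0 - 1 / real k)\<^sup>2 = (r 0)\<^sup>2 - (2 / real k) * r 0 + (1 / real k)\<^sup>2"
    by (simp add: power2_diff)
  then show ?thesis unfolding hsphere_def by auto
qed

text \<open>The equation bounds \<open>r 0\<close> by 2/k, and then each other square by (2/k) times
  \<open>r 0\<close>. The decay in \<open>k\<close> makes points chosen on ever smaller spheres
  converge to \<open>origin\<close>.\<close>

lemma hsphere_coord_le:
  assumes "r \<in> hsphere n k" "k \<ge> 1"
  shows "\<bar>r i\<bar> \<le> 2 / real k"
proof -
  have e: "(r 0)\<^sup>2 + (\<Sum>i\<in>{1..n}. (r i)\<^sup>2) = (2 / real k) * r 0" and z: "\<forall>i>n. r i = 0"
    using assms by (auto simp: hsphere_iff)
  have nn: "(\<Sum>i\<in>{1..n}. (r i)\<^sup>2) \<ge> 0" by (intro sum_nonneg) auto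
  then have sq: "(r 0)\<^sup>2 \<le> (2 / real k) * r 0" using e by linarith
  then have "(2 / real k) * r 0 \<ge> 0" by (smt (verit) zero_le_power2)
  then have p: "r 0 \<ge> 0" using assms(2) by (simp add: zero_le_mult_iff zero_le_divide_iff)
  have b: "r 0 \<le> 2 / real k"
  proof (cases "r 0 = 0")
    case False
    then show ?thesis using sq p by (simp only: power2_eq_square mult_le_cancel_right)
  qed (use assms in auto)
  show ?thesis
  proof (cases "i = 0 \<or> i > n")
    case True
    then show ?thesis using b p z assms by auto
  next
    case False
    then have "(r i)\<^sup>2 \<le> (\<Sum>i\<in>{1..n}. (r i)\<^sup>2)" by (intro member_le_sum) auto
    also have "\<dots> \<le> (2 / real k) * r 0" using e by (smt (verit) zero_le_power2)
    also have "\<dots> \<le> (2 / real k)\<^sup>2" unfolding power2_eq_square using b assms by (intro mult_left_mono) auto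
    finally show ?thesis by (simp add: abs_le_square_iff[symmetric] abs_of_nonneg)
  qed
qed

lemma hsphere_pos:
  assumes "r \<in> hsphere n k" "r \<noteq> origin" "k \<ge> 1"
  shows "r 0 > 0"
proof -
  have e: "(r 0)\<^sup>2 + (\<Sum>i\<in>{1..n}. (r i)\<^sup>2) = (2 / real k) * r 0" and z: "\<forall>i>n. r i = 0"
    using assms by (auto simp: hsphere_iff)
  have nn: "(\<Sum>i\<in>{1..n}. (r i)\<^sup>2) \<ge> 0" by (intro sum_nonneg) auto
  have "(2 / real k) * r 0 \<ge> 0" using e nn by (smt (verit) zero_le_power2)
  then have p: "r 0 \<ge> 0" using assms(3) by (simp add: zero_le_mult_iff zero_le_divide_iff)
  have "r 0 \<noteq> 0"
  proof
    assume 0: "r 0 = 0"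
    then have "(\<Sum>i\<in>{1..n}. (r i)\<^sup>2) = 0" using e by simp
    then have "\<forall>i\<in>{1..n}. r i = 0" by (subst (asm) sum_nonneg_eq_0_iff) auto
    then have "r i = 0" for i using 0 z by (cases "i = 0"; cases "i > n") auto
    then show False using assms(2) by (auto simp: origin_def)
  qed
  with p show ?thesis by simp
qed

lemma hsphere_unique:
  assumes "r \<in> hsphere n k" "r \<in> hsphere n l" "r \<noteq> origin" "k \<ge> 1" "l \<ge> 1"
  shows "k = l"
proof -
  have "(2 / real k) * r 0 = (2 / real l) * r 0"
    using assms by (auto simp: hsphere_iff)
  with hsphere_pos[OF assms(1,3,4)] assms show ?thesis by (simp add: field_simps)
qed

lemma sphere_index_eq:
  assumes "r \<in> hsphere n k" "r \<noteq> origin" "k \<ge> 1"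
  shows "sphere_index n r = k"
  unfolding sphere_index_def
  by (rule the_equality) (use assms hsphere_unique in blast)+

lemma continuous_on_coordinate [continuous_intros]:
  "continuous_on S (\<lambda>x. x i :: 'b::topological_space)"
  by (rule continuous_on_subset[OF continuous_on_product_coordinates]) simp

lemma closed_hsphere: "closed (hsphere n k)"
proof -
  have "hsphere n k = (\<Inter>i\<in>{n<..}. {r. r i = 0}) \<inter>
     {r. (r 0 - 1 / real k)\<^sup>2 + (\<Sum>i\<in>{1..n}. (r i)\<^sup>2) = (1 / real k)\<^sup>2}"
    by (auto simp: hsphere_def)
  also have "closed \<dots>"
    by (intro closed_Int closed_INT ballI closed_Collect_eq continuous_intros)
  finally show ?thesis .
qed

lemma hsphere_subset_hawaiian: "k \<ge> 1 \<Longrightarrow> hsphere n k \<subseteq> hawaiian n"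
  by (auto simp: hawaiian_def)

text \<open>Off the base point, \<open>2 r\<^sub>0 / (r\<^sub>0\<^sup>2 + \<dots> + r\<^sub>n\<^sup>2)\<close> is a continuous function on the
  earring whose value on \<open>S\<^sup>n\<^sub>k\<close> is the integer \<open>k\<close>.\<close>

lemma openin_hsphere_minus_origin:
  assumes "k \<ge> 1"
  shows "openin (top_of_set (hawaiian n)) (hsphere n k - {origin})"
proof -
  let ?S = "\<lambda>r::nat\<Rightarrow>real. (r 0)\<^sup>2 + (\<Sum>i\<in>{1..n}. (r i)\<^sup>2)"
  \<comment> \<open>The integer-valued function described above is trapped strictly between k - 1
    and k + 1, with denominators cleared; \<open>0 < r 0\<close> removes the base point.\<close>
  let ?U = "{r. 0 < r 0} \<inter> {r. (real k - 1) * ?S r < 2 * r 0} \<inter> {r. 2 * r 0 < (real k + 1) * ?S r}"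
  have op: "open ?U"
    by (intro open_Int open_Collect_less continuous_intros)
  have "hsphere n k - {origin} = hawaiian n \<inter> ?U"
  proof (intro equalityI subsetI)
    fix r assume r: "r \<in> hsphere n k - {origin}"
    then have p: "r 0 > 0" using hsphere_pos assms by blast
    have e: "?S r = (2 / real k) * r 0" using r by (auto simp: hsphere_iff)
    have "(real k - 1) * ((2 / real k) * r 0) < 2 * r 0" "2 * r 0 < (real k + 1) * ((2 / real k) * r 0)"
      using p assms by (auto simp: field_simps)
    then show "r \<in> hawaiian n \<inter> ?U" using p r assms unfolding e[symmetric] by (auto simp: hawaiian_def)
  next
    fix r assume r: "r \<in> hawaiian n \<inter> ?U"
    then obtain l where l: "l \<ge> 1" "r \<in> hsphere n l" by (auto simp: hawaiian_def)
    have p: "r 0 > 0" using r by simp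
    have e: "?S r = (2 / real l) * r 0" using l by (auto simp: hsphere_iff)
    have "(real k - 1) * ((2 / real l) * r 0) < 2 * r 0" "2 * r 0 < (real k + 1) * ((2 / real l) * r 0)"
      using r unfolding e[symmetric] by auto
    then have "r 0 * (real k - 1) < r 0 * real l" "r 0 * real l < r 0 * (real k + 1)"
      using l by (auto simp: field_simps)
    then have "real k - 1 < real l" "real l < real k + 1"
      using p by (simp_all only: mult_less_cancel_left_pos)
    then have "k = l" by linarith
    then show "r \<in> hsphere n k - {origin}" using l p by (auto simp: origin_def)
  qed
  then show ?thesis using op by (auto simp: openin_open)
qed

text \<open>Otherwise points outside \<open>V\<close> on infinitely many spheres would converge to
  \<open>origin\<close> in every coordinate, which is convergence in the function space, although
  \<open>V\<close> is a neighbourhood of \<open>origin\<close> in the earring.\<close>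

lemma finite_hspheres_not_subset:
  assumes "openin (top_of_set (hawaiian n)) V" "origin \<in> V"
  shows "finite {k. k \<ge> 1 \<and> \<not> hsphere n k \<subseteq> V}"
proof (rule ccontr)
  let ?B = "{k. k \<ge> 1 \<and> \<not> hsphere n k \<subseteq> V}"
  assume inf: "infinite ?B"
  obtain Q where Q: "open Q" "V = hawaiian n \<inter> Q" using assms(1) by (auto simp: openin_open)
  \<comment> \<open>The default \<open>origin\<close> keeps the bound 2/k valid at every index, also
    at \<open>k = 0\<close> where it reads 0, so the whole sequence converges.\<close>
  define x where "x k = (if k \<in> ?B then SOME r. r \<in> hsphere n k \<and> r \<notin> V else origin)" for k
  have xB: "x k \<in> hsphere n k \<and> x k \<notin> V" if "k \<in> ?B" for k
  proof -
    have "\<exists>r. r \<in> hsphere n k \<and> r \<notin> V" using that by auto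
    from someI_ex[OF this] show ?thesis using that by (simp add: x_def)
  qed
  have bd: "\<bar>x k i\<bar> \<le> 2 / real k" for k i
  proof (cases "k \<in> ?B")
    case True
    then show ?thesis using xB[OF True] hsphere_coord_le by auto
  qed (auto simp: x_def origin_def)
  have "((\<lambda>k. x k i) \<longlongrightarrow> 0) sequentially" for i
  proof (rule Lim_null_comparison)
    show "\<forall>\<^sub>F k in sequentially. norm (x k i) \<le> 2 / real k" using bd by simp
    show "(\<lambda>k. 2 / real k) \<longlonglongrightarrow> 0" by (rule lim_const_over_n)
  qed
  then have "limitin (product_topology (\<lambda>i. euclidean) UNIV) x origin sequentially"
    by (subst limitin_componentwise) (auto simp: origin_def)
  then have "x \<longlonglongrightarrow> origin" by (simp add: euclidean_product_topology)
  moreover have "origin \<in> Q" using Q assms by auto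
  ultimately have "\<forall>\<^sub>F k in sequentially. x k \<in> Q" using Q(1) topological_tendstoD by blast
  then obtain N where N: "\<And>k. k \<ge> N \<Longrightarrow> x k \<in> Q" by (auto simp: eventually_sequentially)
  obtain k where "k \<ge> N" "k \<in> ?B" using inf by (metis (no_types, lifting) infinite_nat_iff_unbounded_le)
  then show False using N[of k] xB[of k] Q hsphere_subset_hawaiian[of k n] by auto
qed

section \<open>The identification of a cube modulo its boundary with a sphere\<close>

definition coord_space :: "nat \<Rightarrow> (nat \<Rightarrow> real) set" where
  "coord_space n = {s. \<forall>i. \<not> (1 \<le> i \<and> i \<le> n) \<longrightarrow> s i = 0}"

definition closed_cube :: "nat \<Rightarrow> (nat \<Rightarrow> real) set" where
  "closed_cube n = {s. (\<forall>i. 1 \<le> i \<and> i \<le> n \<longrightarrow> 0 \<le> s i \<and> s i \<le> 1) \<and>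
                     (\<forall>i. \<not> (1 \<le> i \<and> i \<le> n) \<longrightarrow> s i = 0)}"

lemma open_cube_subset: "open_cube n \<subseteq> closed_cube n" "closed_cube n \<subseteq> coord_space n"
  "open_cube n \<subseteq> coord_space n"
  by (auto simp: open_cube_def closed_cube_def coord_space_def less_imp_le)

lemma compact_closed_cube: "compact (closed_cube n)"
proof -
  have "closed_cube n = PiE UNIV (\<lambda>i. if 1 \<le> i \<and> i \<le> n then {0..1} else {0})"
    by (auto simp: closed_cube_def PiE_def Pi_def split: if_splits)
  moreover have "compactin (product_topology (\<lambda>i. euclidean) UNIV) \<dots>"
    by (subst compactin_PiE) auto
  ultimately show ?thesis by (simp add: euclidean_product_topology)
qed

text \<open>Inverse of \<open>cube_to_sphere\<close>: \<open>r i / r 0\<close> is the stereographic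
  coordinate seen from \<open>origin\<close>, and \<open>arctan\<close> undoes the
  \<open>tan\<close>. The radius cancels in the quotient, so \<open>k\<close> is not an
  argument.\<close>

definition sphere_to_cube :: "nat \<Rightarrow> (nat \<Rightarrow> real) \<Rightarrow> nat \<Rightarrow> real" where
  "sphere_to_cube n r = (\<lambda>i. if 1 \<le> i \<and> i \<le> n then 1/2 + arctan (r i / r 0) / pi else 0)"

lemma sphere_to_cube_in_open_cube: "sphere_to_cube n r \<in> open_cube n"
proof -
  have "0 < 1/2 + arctan x / pi" "1/2 + arctan x / pi < 1" for x
    using arctan_lbound[of x] arctan_ubound[of x] by (auto simp: field_simps)
  then show ?thesis by (auto simp: sphere_to_cube_def open_cube_def)
qed

lemma cube_to_sphere_outside: "s \<notin> open_cube n \<Longrightarrow> cube_to_sphere n k s = origin"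
  by (simp add: cube_to_sphere_def)

lemma cube_to_sphere_inside:
  assumes "s \<in> open_cube n"
  defines "u \<equiv> \<lambda>i. tan (pi * (s i - 1/2))"
  defines "N \<equiv> \<Sum>i\<in>{1..n}. (u i)\<^sup>2"
  shows "cube_to_sphere n k s 0 = (2 / real k) / (1 + N)"
    "1 \<le> i \<Longrightarrow> i \<le> n \<Longrightarrow> cube_to_sphere n k s i = (1 / real k) * (2 * u i) / (1 + N)"
    "i > n \<Longrightarrow> cube_to_sphere n k s i = 0"
  using assms(1) by (auto simp: cube_to_sphere_def u_def N_def Let_def)

text \<open>With N the sum of the squares of the stereographic coordinates u, the image is (1, u)
  scaled by (2/k)/(1 + N). Its squared length is therefore 2/k times its coordinate 0, as
  \<open>hsphere_iff\<close> demands.\<close>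

lemma cube_to_sphere_in_hsphere:
  "cube_to_sphere n k s \<in> hsphere n k"
proof (cases "s \<in> open_cube n")
  case True
  define u where "u i = tan (pi * (s i - 1/2))" for i
  define N where "N = (\<Sum>i\<in>{1..n}. (u i)\<^sup>2)"
  note c = cube_to_sphere_inside[OF True, folded u_def, folded N_def]
  have N0: "N \<ge> 0" unfolding N_def by (intro sum_nonneg) auto
  have "(\<Sum>i\<in>{1..n}. (cube_to_sphere n k s i)\<^sup>2) = (\<Sum>i\<in>{1..n}. ((2 / real k) / (1 + N))\<^sup>2 * (u i)\<^sup>2)"
    by (intro sum.cong) (auto simp: c field_simps)
  also have "\<dots> = ((2 / real k) / (1 + N))\<^sup>2 * N"
    unfolding N_def by (simp add: sum_distrib_left)
  finally have s: "(\<Sum>i\<in>{1..n}. (cube_to_sphere n k s i)\<^sup>2) = ((2 / real k) / (1 + N))\<^sup>2 * N" .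
  have "(1 + N) \<noteq> 0" using N0 by simp
  then have "((2 / real k) / (1 + N))\<^sup>2 + ((2 / real k) / (1 + N))\<^sup>2 * N = (2 / real k) * ((2 / real k) / (1 + N))"
    by (simp add: divide_simps power2_eq_square)
  then show ?thesis unfolding hsphere_iff s c(1) using c(3) by auto
qed (simp add: cube_to_sphere_outside)

lemma cube_to_sphere_neq_origin:
  assumes "s \<in> open_cube n" "k \<ge> 1"
  shows "cube_to_sphere n k s 0 > 0" "cube_to_sphere n k s \<noteq> origin"
proof -
  have "(\<Sum>i\<in>{1..n}. (tan (pi * (s i - 1/2)))\<^sup>2) \<ge> 0" by (intro sum_nonneg) auto
  then show "cube_to_sphere n k s 0 > 0" using assms(2)
    by (simp add: cube_to_sphere_inside(1)[OF assms(1)])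
  then show "cube_to_sphere n k s \<noteq> origin" by (auto simp: origin_def)
qed

lemma sphere_to_cube_inverse:
  assumes "s \<in> open_cube n" "k \<ge> 1"
  shows "sphere_to_cube n (cube_to_sphere n k s) = s"
proof
  fix i
  show "sphere_to_cube n (cube_to_sphere n k s) i = s i"
  proof (cases "1 \<le> i \<and> i \<le> n")
    case True
    define u where "u i = tan (pi * (s i - 1/2))" for i
    define N where "N = (\<Sum>i\<in>{1..n}. (u i)\<^sup>2)"
    note c = cube_to_sphere_inside[OF assms(1), folded u_def, folded N_def]
    have N0: "N \<ge> 0" unfolding N_def by (intro sum_nonneg) auto
    have "cube_to_sphere n k s i / cube_to_sphere n k s 0 = u i"
      using N0 assms(2) True by (simp add: c)
    moreover have "0 < s i" "s i < 1" using assms True by (auto simp: open_cube_def)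
    then have "arctan (u i) = pi * (s i - 1/2)"
      unfolding u_def by (intro arctan_tan) (auto simp: field_simps)
    ultimately show ?thesis using True by (simp add: sphere_to_cube_def)
  next
    case False
    then show ?thesis using assms(1) by (auto simp: sphere_to_cube_def open_cube_def)
  qed
qed

lemma cube_to_sphere_inverse:
  assumes "r \<in> hsphere n k" "r \<noteq> origin" "k \<ge> 1"
  shows "cube_to_sphere n k (sphere_to_cube n r) = r"
proof
  fix i
  have p: "r 0 > 0" using hsphere_pos[OF assms] .
  define s where "s = sphere_to_cube n r"
  have sc: "s \<in> open_cube n" unfolding s_def by (rule sphere_to_cube_in_open_cube)
  define u where "u i = tan (pi * (s i - 1/2))" for i
  define N where "N = (\<Sum>i\<in>{1..n}. (u i)\<^sup>2)"
  note c = cube_to_sphere_inside[OF sc, folded u_def, folded N_def]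
  have u: "u i = r i / r 0" if "1 \<le> i" "i \<le> n" for i
    using that by (simp add: u_def s_def sphere_to_cube_def tan_arctan)
  have "N = (\<Sum>i\<in>{1..n}. (r i)\<^sup>2) / (r 0)\<^sup>2"
    unfolding N_def by (simp add: u power_divide sum_divide_distrib)
  also have "(\<Sum>i\<in>{1..n}. (r i)\<^sup>2) = (2 / real k) * r 0 - (r 0)\<^sup>2"
    using assms(1) by (auto simp: hsphere_iff)
  \<comment> \<open>The sphere equation divided by the square of \<open>r 0\<close> recovers the
    denominator 1 + N.\<close>
  finally have eN: "1 + N = (2 / real k) / r 0"
    using p by (simp add: diff_divide_distrib power2_eq_square)
  have c0: "cube_to_sphere n k s 0 = r 0" "(1 / real k) * (2 * x) / (1 + N) = x * r 0" for x
    unfolding c(1) eN using p assms(3) by simp_all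
  have "cube_to_sphere n k s i = r i"
  proof -
    consider "i = 0" | "1 \<le> i" "i \<le> n" | "i > n" by linarith
    then show ?thesis
    proof cases
      case 1 then show ?thesis using c0 by simp
    next
      case 2 then show ?thesis using c0(2)[of "u i"] u[of i] p by (simp add: c(2))
    next
      case 3 then show ?thesis using c(3) assms(1) by (simp add: hsphere_iff)
    qed
  qed
  then show "cube_to_sphere n k (sphere_to_cube n r) i = r i" by (simp add: s_def)
qed

lemma cube_to_sphere_image:
  assumes "n \<ge> 1" "k \<ge> 1"
  shows "cube_to_sphere n k ` closed_cube n = hsphere n k"
proof
  show "cube_to_sphere n k ` closed_cube n \<subseteq> hsphere n k"
    by (auto simp: cube_to_sphere_in_hsphere)
  show "hsphere n k \<subseteq> cube_to_sphere n k ` closed_cube n"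
  proof
    fix r assume r: "r \<in> hsphere n k"
    show "r \<in> cube_to_sphere n k ` closed_cube n"
    proof (cases "r = origin")
      case True
      have "(\<lambda>_. 0) \<in> closed_cube n" "(\<lambda>_. 0) \<notin> open_cube n"
        using assms by (auto simp: closed_cube_def open_cube_def)
      then show ?thesis using True cube_to_sphere_outside by (metis image_eqI)
    next
      case False
      then show ?thesis using cube_to_sphere_inverse[OF r False assms(2)]
        sphere_to_cube_in_open_cube open_cube_subset(1) by (metis image_eqI subsetD)
    qed
  qed
qed

text \<open>At a boundary point some coordinate \<open>s\<^sub>j\<close> lies outside \<open>(0, 1)\<close>; all coordinates of the
  image are dominated by the continuous function \<open>sin (\<pi> s\<^sub>j)\<close>, cut off outside \<open>[0, 1]\<close>.\<close>

lemma cube_to_sphere_bound: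
  assumes "1 \<le> j" "j \<le> n"
  shows "\<bar>cube_to_sphere n k s i\<bar> \<le> (2 / real k) * sin (pi * max 0 (min 1 (s j)))"
proof (cases "s \<in> open_cube n")
  case True
  define u where "u i = tan (pi * (s i - 1/2))" for i
  define N where "N = (\<Sum>i\<in>{1..n}. (u i)\<^sup>2)"
  note c = cube_to_sphere_inside[OF True, folded u_def, folded N_def]
  have N0: "N \<ge> 0" unfolding N_def by (intro sum_nonneg) auto
  have sj: "0 < s j" "s j < 1" using True assms by (auto simp: open_cube_def)
  then have m: "max 0 (min 1 (s j)) = s j" by simp
  let ?a = "pi * (s j - 1/2)"
  have cs: "cos ?a = sin (pi * s j)" 
    by (simp add: algebra_simps cos_diff)
  have cp: "cos ?a > 0" unfolding cs using sj by (intro sin_gt_zero) auto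
  have uj: "(u j)\<^sup>2 \<le> N" unfolding N_def using assms by (intro member_le_sum) auto
  \<comment> \<open>Since 1 + tan^2 is the inverse of cos^2, a single coordinate close to 0 or 1
    already makes 1/(1 + N) small.\<close>
  have "inverse (1 + N) \<le> inverse (1 + (u j)\<^sup>2)"
    using uj by (intro le_imp_inverse_le) (auto simp: add_pos_nonneg)
  also have "\<dots> = (cos ?a)\<^sup>2" using tan_sec[of ?a] cp by (simp only: u_def power_inverse) simp
  finally have iN: "inverse (1 + N) \<le> (sin (pi * s j))\<^sup>2" by (simp only: cs)
  have sp: "sin (pi * s j) > 0" using cp cs by simp
  have ss: "(sin (pi * s j))\<^sup>2 \<le> sin (pi * s j)"
    unfolding power2_eq_square using sp by (simp add: mult_left_le)
  have k0: "2 / real k \<ge> 0" by simp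
  have "\<bar>cube_to_sphere n k s i\<bar> \<le> (2 / real k) * sin (pi * s j)"
  proof -
    consider "i = 0" | "1 \<le> i" "i \<le> n" | "i > n" by linarith
    then show ?thesis
    proof cases
      case 1
      have "\<bar>cube_to_sphere n k s 0\<bar> = (2 / real k) * inverse (1 + N)"
        using N0 by (simp add: c(1) field_simps)
      also have "\<dots> \<le> (2 / real k) * sin (pi * s j)"
        using iN ss k0 by (intro mult_left_mono) auto
      finally show ?thesis using 1 by simp
    next
      case 2
      have "(u i)\<^sup>2 \<le> N" unfolding N_def using 2 by (intro member_le_sum) auto
      \<comment> \<open>The numerator is at most N, hence at most 1 + N, which cancels one factor of
        the denominator.\<close>
      then have "(u i / (1 + N))\<^sup>2 \<le> (1 + N) / (1 + N)\<^sup>2"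
        unfolding power_divide by (intro divide_right_mono) auto
      also have "\<dots> = inverse (1 + N)" using N0 by (simp add: power2_eq_square divide_inverse)
      also have "\<dots> \<le> (sin (pi * s j))\<^sup>2" by (rule iN)
      finally have "\<bar>u i / (1 + N)\<bar> \<le> sin (pi * s j)"
        using sp by (simp add: abs_le_square_iff[symmetric])
      then have "(2 / real k) * \<bar>u i / (1 + N)\<bar> \<le> (2 / real k) * sin (pi * s j)"
        using k0 by (intro mult_left_mono) auto
      moreover have "\<bar>cube_to_sphere n k s i\<bar> = (2 / real k) * \<bar>u i / (1 + N)\<bar>"
        using 2 by (simp add: c(2) abs_mult)
      ultimately show ?thesis by simp
    next
      case 3
      then show ?thesis using c(3) sp by simp
    qed
  qed
  then show ?thesis by (simp add: m)
next
  case False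
  have "sin (pi * max 0 (min 1 (s j))) \<ge> 0" by (intro sin_ge_zero) auto
  then show ?thesis using False by (simp add: cube_to_sphere_outside origin_def)
qed

lemma openin_open_cube: "openin (top_of_set (coord_space n)) (open_cube n)"
proof -
  have "open (\<Inter>i\<in>{1..n}. {s. 0 < s i} \<inter> {s::nat\<Rightarrow>real. s i < 1})"
    by (intro open_INT ballI open_Int open_Collect_less continuous_intros) auto
  moreover have "open_cube n = coord_space n \<inter> (\<Inter>i\<in>{1..n}. {s. 0 < s i} \<inter> {s::nat\<Rightarrow>real. s i < 1})"
    by (auto simp: open_cube_def coord_space_def)
  ultimately show ?thesis by (auto simp: openin_open)
qed

lemma continuous_on_cube_to_sphere_open_cube:
  "continuous_on (open_cube n) (cube_to_sphere n k)"
proof (rule continuous_on_coordinatewise_then_product)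
  fix i
  define u where "u s i = tan (pi * (s i - 1/2))" for s :: "nat \<Rightarrow> real" and i :: nat
  define N where "N s = (\<Sum>i\<in>{1..n}. (u s i)\<^sup>2)" for s
  have c: "cube_to_sphere n k s 0 = (2 / real k) / (1 + N s)"
    "1 \<le> i \<Longrightarrow> i \<le> n \<Longrightarrow> cube_to_sphere n k s i = (1 / real k) * (2 * u s i) / (1 + N s)"
    "i > n \<Longrightarrow> cube_to_sphere n k s i = 0" if "s \<in> open_cube n" for s
    using cube_to_sphere_inside[OF that] unfolding N_def u_def by blast+
  have N0: "1 + N s \<noteq> 0" for s
  proof -
    have "N s \<ge> 0" unfolding N_def by (intro sum_nonneg) auto
    then show ?thesis by simp
  qed
  have cosn: "cos (pi * (s i - 1/2)) \<noteq> 0" if "s \<in> open_cube n" "i \<in> {1..n}" for i s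
  proof -
    have "cos (pi * (s i - 1/2)) = sin (pi * s i)" by (simp add: algebra_simps cos_diff)
    moreover have "sin (pi * s i) > 0" using that by (intro sin_gt_zero) (auto simp: open_cube_def)
    ultimately show ?thesis by simp
  qed
  have cu: "continuous_on (open_cube n) (\<lambda>s. u s i)" if "i \<in> {1..n}" for i
    unfolding u_def
  proof (rule continuous_on_compose2[of "{x. cos x \<noteq> 0}" tan])
    show "continuous_on {x::real. cos x \<noteq> 0} tan"
      by (intro continuous_on_tan continuous_on_id) auto
    show "continuous_on (open_cube n) (\<lambda>s. pi * (s i - 1 / 2))"
      by (intro continuous_on_mult continuous_on_diff continuous_on_const continuous_on_coordinate)
  qed (use cosn that in auto)
  have cN: "continuous_on (open_cube n) N"
    unfolding N_def by (intro continuous_on_sum continuous_on_power cu)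
  have c1N: "continuous_on (open_cube n) (\<lambda>s. 1 + N s)"
    by (intro continuous_on_add continuous_on_const cN)
  consider "i = 0" | "1 \<le> i" "i \<le> n" | "i > n" by linarith
  then show "continuous_on (open_cube n) (\<lambda>s. cube_to_sphere n k s i)"
  proof cases
    case 1
    have "continuous_on (open_cube n) (\<lambda>s. (2 / real k) / (1 + N s))"
      using N0 by (intro continuous_on_divide continuous_on_const c1N) auto
    then show ?thesis using 1 c(1) by (simp cong: continuous_on_cong)
  next
    case 2
    have "continuous_on (open_cube n) (\<lambda>s. (1 / real k) * (2 * u s i) / (1 + N s))"
      using N0 2 by (intro continuous_on_divide continuous_on_mult continuous_on_const c1N cu) auto
    then show ?thesis using 2 c(2) by (simp cong: continuous_on_cong)
  next
    case 3
    have "continuous_on (open_cube n) (\<lambda>s. 0::real)" by (rule continuous_on_const)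
    then show ?thesis using 3 c(3) by (simp cong: continuous_on_cong)
  qed
qed

text \<open>Inside the open cube the formula is continuous; at any other point a coordinate outside
  (0, 1) squeezes all image coordinates to 0. The domain is all of \<open>coord_space n\<close>
  because reparametrizations of the first coordinate may leave the cube.\<close>

lemma continuous_on_cube_to_sphere:
  assumes "n \<ge> 1"
  shows "continuous_on (coord_space n) (cube_to_sphere n k)"
  unfolding continuous_on_eq_continuous_within
proof
  fix s assume s: "s \<in> coord_space n"
  show "continuous (at s within coord_space n) (cube_to_sphere n k)"
  proof (cases "s \<in> open_cube n")
    case False
    then obtain j where j: "1 \<le> j" "j \<le> n" "\<not> (0 < s j \<and> s j < 1)"
      using s by (auto simp: open_cube_def coord_space_def)
    define b where "b s = (2 / real k) * sin (pi * max 0 (min 1 (s j)))" for s :: "nat \<Rightarrow> real"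
    have b0: "b s = 0" using j by (auto simp: b_def max_def min_def)
    have "continuous_on (coord_space n) b" unfolding b_def by (intro continuous_intros)
    then have b: "(b \<longlongrightarrow> 0) (at s within coord_space n)"
      using s b0 by (metis continuous_on_def)
    have "((\<lambda>s. cube_to_sphere n k s i) \<longlongrightarrow> 0) (at s within coord_space n)" for i
      by (rule Lim_null_comparison[OF _ b]) (use cube_to_sphere_bound[OF j(1,2)] in \<open>auto simp: b_def\<close>)
    then have "limitin (product_topology (\<lambda>i. euclidean) UNIV) (cube_to_sphere n k) origin (at s within coord_space n)"
      by (subst limitin_componentwise) (auto simp: origin_def)
    then show ?thesis using False
      by (simp add: continuous_within cube_to_sphere_outside euclidean_product_topology)
  next
    case True
    obtain V where V: "open V" "open_cube n = coord_space n \<inter> V"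
      using openin_open_cube[of n] by (auto simp: openin_open)
    have "continuous (at s within open_cube n) (cube_to_sphere n k)"
      using True continuous_on_cube_to_sphere_open_cube continuous_on_eq_continuous_within by blast
    \<comment> \<open>The open cube is relatively open in \<open>coord_space n\<close>, so both
      filters agree at its points.\<close>
    moreover have "at s within open_cube n = at s within coord_space n"
      by (rule at_within_nhd[of _ V]) (use V True in auto)
    ultimately show ?thesis by simp
  qed
qed

text \<open>A continuous surjection from a compact space onto a Hausdorff space is a quotient map.
  Continuity on a sphere can thus be tested on the cube.\<close>

lemma quotient_map_cube_to_sphere:
  assumes "n \<ge> 1" "k \<ge> 1"
  shows "quotient_map (top_of_set (closed_cube n)) (top_of_set (hsphere n k)) (cube_to_sphere n k)"
proof (rule continuous_imp_quotient_map)
  have "continuous_on (closed_cube n) (cube_to_sphere n k)"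
    using continuous_on_cube_to_sphere[OF assms(1)] open_cube_subset continuous_on_subset by blast
  then show "continuous_map (top_of_set (closed_cube n)) (top_of_set (hsphere n k)) (cube_to_sphere n k)"
    by (auto simp: cube_to_sphere_in_hsphere)
  show "compact_space (top_of_set (closed_cube n))"
    by (simp add: compact_closed_cube compact_space_subtopology)
  show "Hausdorff_space (top_of_set (hsphere n k))"
    by (simp add: Hausdorff_space_subtopology)
  show "cube_to_sphere n k ` topspace (top_of_set (closed_cube n)) = topspace (top_of_set (hsphere n k))"
    using cube_to_sphere_image[OF assms] by simp
qed

section \<open>The topology of the weak join\<close>


lemma hemb_origin [simp]: "hemb n origin = hbase"
  by (simp add: hemb_def)

lemma hemb_eq_hbase_iff [simp]: "hemb n r = hbase \<longleftrightarrow> r = origin"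
  by (auto simp: hemb_def hbase_def)

lemma hemb_eq_iff: "hemb n r = hemb m q \<longleftrightarrow> (r = origin \<and> q = origin) \<or> (n = m \<and> r = q)"
  by (auto simp: hemb_def hbase_def)

lemma openin_hinf_raw:
  "openin hinf_top U \<longleftrightarrow> U \<subseteq> hinf_set
      \<and> (\<forall>n\<ge>1. openin (hawaiian_top n) {r \<in> hawaiian n. hemb n r \<in> U})
      \<and> (hbase \<in> U \<longrightarrow> finite {n. n \<ge> 1 \<and> \<not> hemb n ` hawaiian n \<subseteq> U})"
proof -
  let ?P = "\<lambda>U. U \<subseteq> hinf_set
      \<and> (\<forall>n\<ge>1. openin (hawaiian_top n) {r \<in> hawaiian n. hemb n r \<in> U})
      \<and> (hbase \<in> U \<longrightarrow> finite {n. n \<ge> 1 \<and> \<not> hemb n ` hawaiian n \<subseteq> U})"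
  have "istopology ?P"
    unfolding istopology_def
  proof (intro conjI allI impI)
    fix S T assume S: "?P S" and T: "?P T"
    have "{r \<in> hawaiian n. hemb n r \<in> S \<inter> T} = {r \<in> hawaiian n. hemb n r \<in> S} \<inter> {r \<in> hawaiian n. hemb n r \<in> T}" for n
      by auto
    then show "openin (hawaiian_top n) {r \<in> hawaiian n. hemb n r \<in> S \<inter> T}" if "n \<ge> 1" for n
      using S T that by (metis (no_types, lifting) openin_Int)
    have "finite ({n. n \<ge> 1 \<and> \<not> hemb n ` hawaiian n \<subseteq> S} \<union> {n. n \<ge> 1 \<and> \<not> hemb n ` hawaiian n \<subseteq> T})"
      if "hbase \<in> S \<inter> T" using S T that by simp
    then show "finite {n. n \<ge> 1 \<and> \<not> hemb n ` hawaiian n \<subseteq> S \<inter> T}" if "hbase \<in> S \<inter> T"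
      by (rule finite_subset[rotated]) (use that in auto)
    show "S \<inter> T \<subseteq> hinf_set" using S by blast
  next
    fix K assume K: "\<forall>S\<in>K. ?P S"
    have "{r \<in> hawaiian n. hemb n r \<in> \<Union>K} = (\<Union>S\<in>K. {r \<in> hawaiian n. hemb n r \<in> S})" for n
      by auto
    moreover have "openin (hawaiian_top n) (\<Union>S\<in>K. {r \<in> hawaiian n. hemb n r \<in> S})" if "n \<ge> 1" for n
      using K that by (intro openin_Union) auto
    ultimately show "openin (hawaiian_top n) {r \<in> hawaiian n. hemb n r \<in> \<Union>K}" if "n \<ge> 1" for n
      using that by metis
    show "finite {n. n \<ge> 1 \<and> \<not> hemb n ` hawaiian n \<subseteq> \<Union>K}" if b: "hbase \<in> \<Union>K"
    proof -
      obtain S where "S \<in> K" "hbase \<in> S" using b by blast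
      then have "finite {n. n \<ge> 1 \<and> \<not> hemb n ` hawaiian n \<subseteq> S}" using K by blast
      then show ?thesis by (rule rev_finite_subset) (use \<open>S \<in> K\<close> in blast)
    qed
    show "\<Union>K \<subseteq> hinf_set" using K by blast
  qed
  then show ?thesis unfolding hinf_top_def by (subst topology_inverse') (assumption, rule refl)
qed

lemma hinf_setE:
  assumes "p \<in> hinf_set"
  obtains n k r where "n \<ge> 1" "k \<ge> 1" "r \<in> hsphere n k" "p = hemb n r"
  using assms unfolding hinf_set_def hawaiian_def by auto

lemma hemb_in_hinf_set: "n \<ge> 1 \<Longrightarrow> k \<ge> 1 \<Longrightarrow> r \<in> hsphere n k \<Longrightarrow> hemb n r \<in> hinf_set"
  unfolding hinf_set_def hawaiian_def by auto

lemma hbase_in_hinf_set [simp]: "hbase \<in> hinf_set"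
  using hemb_in_hinf_set[of 1 1 origin] by simp

lemma hemb_hsphere_cases:
  assumes "n \<ge> 1" "k \<ge> 1" "r \<in> hsphere n k" "m \<ge> 1" "l \<ge> 1" "q \<in> hsphere m l"
    "hemb n r = hemb m q" "r \<noteq> origin"
  shows "n = m" "k = l" "r = q"
  using assms hsphere_unique by (auto simp: hemb_eq_iff)

text \<open>The finiteness over \<open>n\<close> in the join and over \<open>k\<close> in each
  earring combine into one condition on pairs, as finitely many finite sets have a finite union.
  Later arguments see only spheres and pairs of indices.\<close>

lemma openin_hinf_iff:
  "openin hinf_top U \<longleftrightarrow> U \<subseteq> hinf_set
      \<and> (\<forall>n\<ge>1. \<forall>k\<ge>1. openin (top_of_set (hsphere n k)) {r \<in> hsphere n k. hemb n r \<in> U})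
      \<and> (hbase \<in> U \<longrightarrow> finite {(n, k). n \<ge> 1 \<and> k \<ge> 1 \<and> \<not> hemb n ` hsphere n k \<subseteq> U})"
    (is "?L \<longleftrightarrow> ?R")
proof
  assume L: ?L
  then have R: "U \<subseteq> hinf_set"
    and op: "\<And>n. n \<ge> 1 \<Longrightarrow> openin (top_of_set (hawaiian n)) {r \<in> hawaiian n. hemb n r \<in> U}"
    and fin: "hbase \<in> U \<Longrightarrow> finite {n. n \<ge> 1 \<and> \<not> hemb n ` hawaiian n \<subseteq> U}"
    by (auto simp: openin_hinf_raw hawaiian_top_def)
  have "openin (top_of_set (hsphere n k)) {r \<in> hsphere n k. hemb n r \<in> U}" if nk: "n \<ge> 1" "k \<ge> 1" for n k
  proof -
    obtain V where V: "open V" "{r \<in> hawaiian n. hemb n r \<in> U} = hawaiian n \<inter> V"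
      using op[OF nk(1)] by (auto simp: openin_open)
    then have "{r \<in> hsphere n k. hemb n r \<in> U} = hsphere n k \<inter> V"
      using hsphere_subset_hawaiian[OF nk(2), of n] by blast
    then show ?thesis using V(1) by (auto simp: openin_open)
  qed
  moreover have "finite {(n, k). n \<ge> 1 \<and> k \<ge> 1 \<and> \<not> hemb n ` hsphere n k \<subseteq> U}" if b: "hbase \<in> U"
  proof (rule finite_subset)
    let ?N = "{n. n \<ge> 1 \<and> \<not> hemb n ` hawaiian n \<subseteq> U}"
    let ?K = "\<lambda>n. {k. k \<ge> 1 \<and> \<not> hsphere n k \<subseteq> {r \<in> hawaiian n. hemb n r \<in> U}}"
    show "{(n, k). n \<ge> 1 \<and> k \<ge> 1 \<and> \<not> hemb n ` hsphere n k \<subseteq> U} \<subseteq> (SIGMA n:?N. ?K n)"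
      using hsphere_subset_hawaiian by fastforce
    have "finite (?K n)" if "n \<in> ?N" for n
      using that b by (intro finite_hspheres_not_subset op) (auto intro: subsetD[OF hsphere_subset_hawaiian[of 1]])
    then show "finite (SIGMA n:?N. ?K n)" using fin[OF b] by blast
  qed
  ultimately show ?R using R by blast
next
  assume R: ?R
  let ?S = "\<lambda>n k. {r \<in> hsphere n k. hemb n r \<in> U}"
  let ?B = "{(n, k). n \<ge> 1 \<and> k \<ge> 1 \<and> \<not> hemb n ` hsphere n k \<subseteq> U}"
  have op: "openin (top_of_set (hsphere n k)) (?S n k)" if "n \<ge> 1" "k \<ge> 1" for n k
    using R that by blast
  have "openin (top_of_set (hawaiian n)) {r \<in> hawaiian n. hemb n r \<in> U}" if n: "n \<ge> 1" for n
  proof (cases "hbase \<in> U")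
    case True
    let ?K = "{k. k \<ge> 1 \<and> \<not> hemb n ` hsphere n k \<subseteq> U}"
    have "finite ?K"
    proof (rule finite_subset)
      show "?K \<subseteq> snd ` ?B" using n by force
      show "finite (snd ` ?B)" using R True by blast
    qed
    have "closed (hsphere n k - ?S n k)" if "k \<ge> 1" for k
      using op[OF n that] by (metis (no_types, lifting) closed_hsphere closedin_closed_trans closedin_diff closedin_topspace topspace_euclidean_subtopology)
    \<comment> \<open>With the base point in \<open>U\<close> only finitely many spheres leave
      \<open>U\<close>, so the complement of its trace on the earring is a finite union of closed
      sets.\<close>
    then have "closed (\<Union>k\<in>?K. hsphere n k - ?S n k)"
      using \<open>finite ?K\<close> by (intro closed_UN) auto
    moreover have "{r \<in> hawaiian n. hemb n r \<in> U} = hawaiian n \<inter> - (\<Union>k\<in>?K. hsphere n k - ?S n k)"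
      by (force simp: hawaiian_def)
    ultimately show ?thesis by (auto simp: openin_open open_Compl)
  next
    case False
    \<comment> \<open>Without the base point every piece lies in a punctured sphere, and punctured
      spheres are open in the earring.\<close>
    have "openin (top_of_set (hawaiian n)) (?S n k)" if k: "k \<ge> 1" for k
    proof -
      have "origin \<notin> ?S n k" using False by simp
      moreover obtain V where "open V" "?S n k = hsphere n k \<inter> V"
        using op[OF n k] by (auto simp: openin_open)
      moreover obtain V' where "open V'" "hsphere n k - {origin} = hawaiian n \<inter> V'"
        using openin_hsphere_minus_origin[OF k, of n] by (auto simp: openin_open)
      ultimately have "?S n k = hawaiian n \<inter> (V' \<inter> V)" "open (V' \<inter> V)" by auto
      then show ?thesis by (auto simp: openin_open)
    qed
    then have "openin (top_of_set (hawaiian n)) (\<Union>k\<in>{1..}. ?S n k)" by blast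
    moreover have "{r \<in> hawaiian n. hemb n r \<in> U} = (\<Union>k\<in>{1..}. ?S n k)" by (auto simp: hawaiian_def)
    ultimately show ?thesis by simp
  qed
  moreover have "finite {n. n \<ge> 1 \<and> \<not> hemb n ` hawaiian n \<subseteq> U}" if "hbase \<in> U"
  proof (rule finite_subset)
    show "{n. n \<ge> 1 \<and> \<not> hemb n ` hawaiian n \<subseteq> U} \<subseteq> fst ` ?B"
      by (force simp: hawaiian_def)
    show "finite (fst ` ?B)" using R that by blast
  qed
  ultimately show ?L using R by (simp add: openin_hinf_raw hawaiian_top_def)
qed

lemma topspace_hinf [simp]: "topspace hinf_top = hinf_set"
proof
  show "topspace hinf_top \<subseteq> hinf_set"
    using openin_topspace[of hinf_top] unfolding openin_hinf_iff by (rule conjunct1)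
  have "{r \<in> hsphere n k. hemb n r \<in> hinf_set} = hsphere n k" if "n \<ge> 1" "k \<ge> 1" for n k
    using that hemb_in_hinf_set by blast
  then have "openin hinf_top hinf_set"
    unfolding openin_hinf_iff using hemb_in_hinf_set by (auto intro!: finite_subset[of _ "{}"])
  then show "hinf_set \<subseteq> topspace hinf_top" by (rule openin_subset)
qed

lemma continuous_map_hemb:
  assumes "n \<ge> 1" "k \<ge> 1"
  shows "continuous_map (top_of_set (hsphere n k)) hinf_top (hemb n)"
  unfolding continuous_map_def
  using assms hemb_in_hinf_set by (auto simp: openin_hinf_iff)

section \<open>Null families and the continuity criterion for the weak join\<close>

definition null_family :: "'b topology \<Rightarrow> 'b \<Rightarrow> (nat \<Rightarrow> nat \<Rightarrow> 'b set) \<Rightarrow> bool" where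
  "null_family Y y B \<longleftrightarrow> (\<forall>W. openin Y W \<longrightarrow> y \<in> W \<longrightarrow>
     finite {(n, k). n \<ge> 1 \<and> k \<ge> 1 \<and> \<not> B n k \<subseteq> W})"

text \<open>Adding \<open>y\<close> is harmless because every \<open>W\<close> under test contains
  it. Two source families serve products of maps; the finite exceptional set serves changes on
  finitely many spheres.\<close>

lemma null_family_mono:
  assumes "null_family Y y B" "null_family Y y B'"
    "finite {(n, k). n \<ge> 1 \<and> k \<ge> 1 \<and> \<not> C n k \<subseteq> insert y (B n k \<union> B' n k)}"
  shows "null_family Y y C"
  unfolding null_family_def
proof (intro allI impI)
  fix W assume W: "openin Y W" "y \<in> W"
  let ?f = "\<lambda>B. {(n, k). n \<ge> 1 \<and> k \<ge> 1 \<and> \<not> B n k \<subseteq> W}"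
  have "finite (?f B \<union> ?f B' \<union> {(n, k). n \<ge> 1 \<and> k \<ge> 1 \<and> \<not> C n k \<subseteq> insert y (B n k \<union> B' n k)})"
    using assms W by (simp add: null_family_def)
  then show "finite (?f C)" by (rule rev_finite_subset) (use W in blast)
qed

text \<open>Only finitely many spheres are cut, each in a relatively closed part away from the base
  point, so what remains is open. This yields the neighbourhood that controls the finitely many
  spheres not already small.\<close>

lemma openin_hinf_avoiding:
  assumes Q: "finite Q" and Q1: "\<And>n k. (n, k) \<in> Q \<Longrightarrow> n \<ge> 1 \<and> k \<ge> 1"
    and B: "\<And>n k. (n, k) \<in> Q \<Longrightarrow> openin (top_of_set (hsphere n k)) (B n k) \<and> origin \<in> B n k"
  obtains V where "openin hinf_top V" "hbase \<in> V"
    "\<And>n k r. (n, k) \<in> Q \<Longrightarrow> r \<in> hsphere n k \<Longrightarrow> hemb n r \<in> V \<Longrightarrow> r \<in> B n k"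
proof
  define C where "C = (\<Union>(n, k)\<in>Q. hemb n ` (hsphere n k - B n k))"
  have hb: "hbase \<notin> C"
  proof
    assume "hbase \<in> C"
    then obtain n k r where "(n, k) \<in> Q" "r \<notin> B n k" "hbase = hemb n r" by (auto simp: C_def)
    then show False using B[of n k] by (metis hemb_eq_hbase_iff)
  qed
  have mem: "hemb n r \<in> C \<longleftrightarrow> (n, k) \<in> Q \<and> r \<notin> B n k" if "n \<ge> 1" "k \<ge> 1" "r \<in> hsphere n k" for n k r
  proof
    assume *: "hemb n r \<in> C"
    with hb have ro: "r \<noteq> origin" by auto
    from * obtain m l q where q: "(m, l) \<in> Q" "q \<in> hsphere m l" "q \<notin> B m l" "hemb n r = hemb m q"
      by (auto simp: C_def)
    then have "n = m" "k = l" "r = q"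
      using hemb_hsphere_cases[OF that, of m l q] ro Q1[of m l] by blast+
    with q show "(n, k) \<in> Q \<and> r \<notin> B n k" by simp
  next
    assume "(n, k) \<in> Q \<and> r \<notin> B n k"
    then show "hemb n r \<in> C" using that unfolding C_def by blast
  qed
  show "openin hinf_top (hinf_set - C)"
    unfolding openin_hinf_iff
  proof (intro conjI allI impI)
    fix n k :: nat assume nk: "n \<ge> 1" "k \<ge> 1"
    show "openin (top_of_set (hsphere n k)) {r \<in> hsphere n k. hemb n r \<in> hinf_set - C}"
    proof (cases "(n, k) \<in> Q")
      case True
      then have "{r \<in> hsphere n k. hemb n r \<in> hinf_set - C} = hsphere n k \<inter> B n k"
        using mem[OF nk] hemb_in_hinf_set[OF nk] by blast
      then show ?thesis using B[OF True] by (auto simp: openin_open)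
    next
      case False
      then have "{r \<in> hsphere n k. hemb n r \<in> hinf_set - C} = hsphere n k"
        using mem[OF nk] hemb_in_hinf_set[OF nk] by blast
      then show ?thesis by simp
    qed
  next
    show "finite {(n, k). n \<ge> 1 \<and> k \<ge> 1 \<and> \<not> hemb n ` hsphere n k \<subseteq> hinf_set - C}"
      by (rule finite_subset[OF _ Q]) (use mem hemb_in_hinf_set in blast)
  qed auto
  show "hbase \<in> hinf_set - C" using hb by simp
  fix n k r assume "(n, k) \<in> Q" "r \<in> hsphere n k" "hemb n r \<in> hinf_set - C"
  then show "r \<in> B n k" using mem[of n k r] Q1[of n k] by blast
qed

text \<open>Off the base point the join is locally a single sphere, since different spheres meet
  only at the base point.\<close>

lemma openin_hinf_hemb_image:
  assumes nk: "n \<ge> 1" "k \<ge> 1" and B: "openin (top_of_set (hsphere n k)) B" "origin \<notin> B"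
  shows "openin hinf_top (hemb n ` B)"
  unfolding openin_hinf_iff
proof (intro conjI allI impI)
  have Bs: "B \<subseteq> hsphere n k" using openin_subset[OF B(1)] by simp
  then show "hemb n ` B \<subseteq> hinf_set" using hemb_in_hinf_set[OF nk] by auto
  fix m l :: nat assume ml: "m \<ge> 1" "l \<ge> 1"
  have *: "n = m \<and> k = l \<and> b = q" if "b \<in> B" "q \<in> hsphere m l" "hemb n b = hemb m q" for b q
    using hemb_hsphere_cases[OF nk _ ml, of b q] that Bs B(2) by blast
  show "openin (top_of_set (hsphere m l)) {q \<in> hsphere m l. hemb m q \<in> hemb n ` B}"
  proof (cases "m = n \<and> l = k")
    case True
    then have "{q \<in> hsphere m l. hemb m q \<in> hemb n ` B} = B"
      using * Bs by (auto simp: image_iff) metis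
    then show ?thesis using B True by simp
  next
    case False
    then have "{q \<in> hsphere m l. hemb m q \<in> hemb n ` B} = {}"
      using * by (auto simp: image_iff) metis+
    then show ?thesis by (simp only: openin_empty)
  qed
next
  assume "hbase \<in> hemb n ` B"
  then have "origin \<in> B" by (metis hemb_eq_hbase_iff imageE)
  then show "finite {(m, l). m \<ge> 1 \<and> l \<ge> 1 \<and> \<not> hemb m ` hsphere m l \<subseteq> hemb n ` B}"
    using B(2) by blast
qed

text \<open>Off the base point continuity is inherited from one sphere. At the base point smallness,
  uniform in the parameter, handles all but finitely many spheres, and for the remaining ones the
  neighbourhoods given by continuity on each are intersected.\<close>

lemma continuous_map_prod_hinf:
  assumes F: "\<And>n k. n \<ge> 1 \<Longrightarrow> k \<ge> 1 \<Longrightarrow>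
      continuous_map (prod_topology I (top_of_set (hsphere n k))) Y (\<lambda>(u, r). F (u, hemb n r))"
    and base: "\<And>u. u \<in> topspace I \<Longrightarrow> F (u, hbase) = y"
    and small: "null_family Y y (\<lambda>n k. (\<lambda>(u, r). F (u, hemb n r)) ` (topspace I \<times> hsphere n k))"
  shows "continuous_map (prod_topology I hinf_top) Y F"
  unfolding continuous_map_def
proof (intro conjI allI impI)
  have FY: "F (u, hemb n r) \<in> topspace Y" if "u \<in> topspace I" "n \<ge> 1" "k \<ge> 1" "r \<in> hsphere n k" for u n k r
    using continuous_map_funspace[OF F[OF that(2,3)]] that by (auto simp: Pi_iff)
  show "F \<in> topspace (prod_topology I hinf_top) \<rightarrow> topspace Y"
  proof
    fix x assume "x \<in> topspace (prod_topology I hinf_top)"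
    then obtain u p where x: "x = (u, p)" "u \<in> topspace I" "p \<in> hinf_set" by auto
    obtain n k r where "n \<ge> 1" "k \<ge> 1" "r \<in> hsphere n k" "p = hemb n r" using hinf_setE[OF x(3)] .
    then show "F x \<in> topspace Y" using FY x by simp
  qed
  fix W assume W: "openin Y W"
  have loc: "\<exists>A B. openin I A \<and> openin (top_of_set (hsphere n k)) B \<and> u \<in> A \<and> r \<in> B \<and>
      (\<forall>u'\<in>A. \<forall>r'\<in>B. F (u', hemb n r') \<in> W)"
    if nk: "n \<ge> 1" "k \<ge> 1" and "u \<in> topspace I" "r \<in> hsphere n k" "F (u, hemb n r) \<in> W" for n k u r
  proof -
    let ?S = "{x \<in> topspace (prod_topology I (top_of_set (hsphere n k))). (\<lambda>(u, r). F (u, hemb n r)) x \<in> W}"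
    have "openin (prod_topology I (top_of_set (hsphere n k))) ?S"
      using openin_continuous_map_preimage[OF F[OF nk] W] .
    moreover have "(u, r) \<in> ?S" using that by simp
    ultimately have "\<exists>A B. openin I A \<and> openin (top_of_set (hsphere n k)) B \<and> u \<in> A \<and> r \<in> B \<and> A \<times> B \<subseteq> ?S"
      unfolding openin_prod_topology_alt by (elim allE impE)
    then obtain A B where "openin I A" "openin (top_of_set (hsphere n k)) B" "u \<in> A" "r \<in> B" "A \<times> B \<subseteq> ?S"
      by (elim exE conjE)
    then show ?thesis by (intro exI[of _ A] exI[of _ B]) auto
  qed
  have "\<exists>A B. openin I A \<and> openin hinf_top B \<and> u \<in> A \<and> p \<in> B \<and> (\<forall>u'\<in>A. \<forall>p'\<in>B. F (u', p') \<in> W)"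
    if u: "u \<in> topspace I" and p: "p \<in> hinf_set" and W': "F (u, p) \<in> W" for u p
  proof (cases "p = hbase")
    case True
    then have yW: "y \<in> W" using W' base u by simp
    define Q where "Q = {(n, k). n \<ge> 1 \<and> k \<ge> 1 \<and> \<not> (\<lambda>(u, r). F (u, hemb n r)) ` (topspace I \<times> hsphere n k) \<subseteq> W}"
    have Q: "finite Q" using small W yW by (simp add: null_family_def Q_def)
    have Q1: "n \<ge> 1 \<and> k \<ge> 1" if "(n, k) \<in> Q" for n k using that by (simp add: Q_def)
    have notQ: "F (u, hemb n r) \<in> W" if "(n, k) \<notin> Q" "n \<ge> 1" "k \<ge> 1" "u \<in> topspace I" "r \<in> hsphere n k" for n k u r
      using that by (auto simp: Q_def)
    define G where "G n k A B \<longleftrightarrow> openin I A \<and> openin (top_of_set (hsphere n k)) B \<and> u \<in> A \<and> origin \<in> B \<and>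
      (\<forall>u'\<in>A. \<forall>r'\<in>B. F (u', hemb n r') \<in> W)" for n k A B
    have "\<exists>A B. G n k A B" if "(n, k) \<in> Q" for n k
      unfolding G_def by (rule loc) (use Q1[OF that] u W' True in simp_all)
    then obtain A B where G: "\<And>n k. (n, k) \<in> Q \<Longrightarrow> G n k (A n k) (B n k)" by metis
    note AB = G[unfolded G_def]
    \<comment> \<open>A finite intersection of parameter neighbourhoods; the factor
      \<open>topspace I\<close> covers the case of empty \<open>Q\<close>.\<close>
    define A' where "A' = topspace I \<inter> (\<Inter>(n, k)\<in>Q. A n k)"
    have A': "openin I A'"
    proof (cases "Q = {}")
      case False
      have "openin I (\<Inter>((\<lambda>(n, k). A n k) ` Q))"
        by (rule openin_Inter) (use Q False AB in auto)
      then show ?thesis unfolding A'_def by (intro openin_Int) auto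
    next
      case True
      then show ?thesis unfolding A'_def True by simp
    qed
    have uA': "u \<in> A'" using u AB by (auto simp: A'_def)
    obtain V where V: "openin hinf_top V" "hbase \<in> V"
        "\<And>n k r. (n, k) \<in> Q \<Longrightarrow> r \<in> hsphere n k \<Longrightarrow> hemb n r \<in> V \<Longrightarrow> r \<in> B n k"
      using openin_hinf_avoiding[OF Q Q1, of B] AB by blast
    have "F (u', p') \<in> W" if u': "u' \<in> A'" and p': "p' \<in> V" for u' p'
    proof -
      have "p' \<in> hinf_set" using p' openin_subset[OF V(1)] by auto
      then obtain n k r where r: "n \<ge> 1" "k \<ge> 1" "r \<in> hsphere n k" "p' = hemb n r"
        by (rule hinf_setE)
      show ?thesis
      proof (cases "(n, k) \<in> Q")
        case True
        then have "r \<in> B n k" using V(3)[OF True r(3)] p' r(4) by simp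
        moreover have "u' \<in> A n k" using True u' unfolding A'_def by blast
        ultimately show ?thesis using AB[OF True] r(4) by simp
      next
        case False
        have "u' \<in> topspace I" using u' by (simp add: A'_def)
        then show ?thesis using notQ[OF False r(1,2)] r by simp
      qed
    qed
    then show ?thesis using A' uA' V True by (intro exI[of _ A'] exI[of _ V]) simp
  next
    case False
    obtain n k r where r: "n \<ge> 1" "k \<ge> 1" "r \<in> hsphere n k" "p = hemb n r"
      using p by (rule hinf_setE)
    obtain A B where AB: "openin I A" "openin (top_of_set (hsphere n k)) B" "u \<in> A" "r \<in> B"
        "\<forall>u'\<in>A. \<forall>r'\<in>B. F (u', hemb n r') \<in> W"
      using loc[OF r(1,2) u r(3)] W' r(4) by blast
    have "openin (top_of_set (hsphere n k)) (B - {origin})"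
      by (intro openin_diff AB(2)) simp
    then have "openin hinf_top (hemb n ` (B - {origin}))"
      by (rule openin_hinf_hemb_image[OF r(1,2)]) simp
    moreover have "p \<in> hemb n ` (B - {origin})" using AB r False by auto
    moreover have "\<forall>u'\<in>A. \<forall>p'\<in>hemb n ` (B - {origin}). F (u', p') \<in> W" using AB(5) by blast
    ultimately show ?thesis using AB(1,3) by (intro exI[of _ A] exI[of _ "hemb n ` (B - {origin})"]) simp
  qed
  note pt = this
  show "openin (prod_topology I hinf_top) {x \<in> topspace (prod_topology I hinf_top). F x \<in> W}"
    unfolding openin_prod_topology_alt
  proof (intro allI impI)
    fix u p assume "(u, p) \<in> {x \<in> topspace (prod_topology I hinf_top). F x \<in> W}"
    then have "u \<in> topspace I" "p \<in> hinf_set" "F (u, p) \<in> W" by auto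
    from pt[OF this] obtain A B where AB: "openin I A" "openin hinf_top B" "u \<in> A" "p \<in> B" "\<forall>u'\<in>A. \<forall>p'\<in>B. F (u', p') \<in> W" by blast
    moreover have "A \<times> B \<subseteq> {x \<in> topspace (prod_topology I hinf_top). F x \<in> W}"
      using AB openin_subset[OF AB(1)] openin_subset[OF AB(2)] by auto
    ultimately show "\<exists>U V. openin I U \<and> openin hinf_top V \<and> u \<in> U \<and> p \<in> V \<and>
        U \<times> V \<subseteq> {x \<in> topspace (prod_topology I hinf_top). F x \<in> W}"
      by blast
  qed
qed

lemma continuous_map_prod_hinfD:
  assumes "continuous_map (prod_topology I hinf_top) Y F" "n \<ge> 1" "k \<ge> 1"
  shows "continuous_map (prod_topology I (top_of_set (hsphere n k))) Y (\<lambda>(u, r). F (u, hemb n r))"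
proof -
  have "continuous_map (prod_topology I (top_of_set (hsphere n k))) (prod_topology I hinf_top) (\<lambda>x. (fst x, hemb n (snd x)))"
    by (intro continuous_map_pairedI continuous_map_fst continuous_map_compose[OF continuous_map_snd continuous_map_hemb[OF assms(2,3)], unfolded o_def])
  from continuous_map_compose[OF this assms(1)] show ?thesis by (simp add: o_def case_prod_unfold)
qed

text \<open>The tube lemma replaces the neighbourhoods of \<open>hbase\<close> at single parameters
  by one that serves all of them, and this one contains all but finitely many spheres.\<close>

lemma null_family_homotopy:
  assumes F: "continuous_map (prod_topology I hinf_top) Y F" and I: "compact_space I"
    and base: "\<And>u. u \<in> topspace I \<Longrightarrow> F (u, hbase) = y"
  shows "null_family Y y (\<lambda>n k. (\<lambda>(u, r). F (u, hemb n r)) ` (topspace I \<times> hsphere n k))"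
  unfolding null_family_def
proof (intro allI impI)
  fix W assume W: "openin Y W" "y \<in> W"
  let ?S = "{x \<in> topspace (prod_topology I hinf_top). F x \<in> W}"
  have "\<exists>U V. openin I U \<and> openin hinf_top V \<and> topspace I \<subseteq> U \<and> hbase \<in> V \<and> U \<times> V \<subseteq> ?S"
    by (rule tube_lemma_left) (use openin_continuous_map_preimage[OF F W(1)] I base W in \<open>auto simp: compact_space_def\<close>)
  then obtain U V where V: "openin hinf_top V" "topspace I \<subseteq> U" "hbase \<in> V" "U \<times> V \<subseteq> ?S" by blast
  then have "finite {(n, k). n \<ge> 1 \<and> k \<ge> 1 \<and> \<not> hemb n ` hsphere n k \<subseteq> V}"
    by (simp add: openin_hinf_iff)
  then show "finite {(n, k). n \<ge> 1 \<and> k \<ge> 1 \<and> \<not> (\<lambda>(u, r). F (u, hemb n r)) ` (topspace I \<times> hsphere n k) \<subseteq> W}"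
  proof (rule rev_finite_subset)
    show "{(n, k). n \<ge> 1 \<and> k \<ge> 1 \<and> \<not> (\<lambda>(u, r). F (u, hemb n r)) ` (topspace I \<times> hsphere n k) \<subseteq> W}
       \<subseteq> {(n, k). n \<ge> 1 \<and> k \<ge> 1 \<and> \<not> hemb n ` hsphere n k \<subseteq> V}"
      using V(2,4) by fastforce
  qed
qed

section \<open>Based maps as null families on cubes\<close>


lemma null_family_subset:
  assumes "null_family Y y B" "null_family Y y B'"
    "\<And>n k. n \<ge> 1 \<Longrightarrow> k \<ge> 1 \<Longrightarrow> C n k \<subseteq> insert y (B n k \<union> B' n k)"
  shows "null_family Y y C"
proof (rule null_family_mono[OF assms(1,2)])
  have "{(n, k). n \<ge> 1 \<and> k \<ge> 1 \<and> \<not> C n k \<subseteq> insert y (B n k \<union> B' n k)} = {}"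
    using assms(3) by blast
  then show "finite {(n, k). n \<ge> 1 \<and> k \<ge> 1 \<and> \<not> C n k \<subseteq> insert y (B n k \<union> B' n k)}"
    by (simp only: finite.emptyI)
qed

lemma null_family_subset1:
  assumes "null_family Y y B" "\<And>n k. n \<ge> 1 \<Longrightarrow> k \<ge> 1 \<Longrightarrow> C n k \<subseteq> insert y (B n k)"
  shows "null_family Y y C"
  by (rule null_family_subset[OF assms(1,1)]) (use assms(2) in simp)

definition cube_rep :: "(nat \<times> (nat \<Rightarrow> real) \<Rightarrow> 'b) \<Rightarrow> nat \<Rightarrow> nat \<Rightarrow> (nat \<Rightarrow> real) \<Rightarrow> 'b" where
  "cube_rep f n k s = f (hemb n (cube_to_sphere n k s))"

text \<open>Inverse to \<open>cube_rep\<close>. It reads \<open>A\<close> on open cubes and assigns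
  \<open>y\<close> to the base point, so continuity will rest on \<open>A\<close> taking the value
  \<open>y\<close> on the boundary.\<close>

definition of_cubes :: "'b \<Rightarrow> (nat \<Rightarrow> nat \<Rightarrow> (nat \<Rightarrow> real) \<Rightarrow> 'b) \<Rightarrow> nat \<times> (nat \<Rightarrow> real) \<Rightarrow> 'b" where
  "of_cubes y A p = (if p = hbase then y
     else A (fst p) (sphere_index (fst p) (snd p)) (sphere_to_cube (fst p) (snd p)))"

abbreviation hhom :: "'b topology \<Rightarrow> 'b \<Rightarrow> (nat \<times> (nat \<Rightarrow> real) \<Rightarrow> 'b) \<Rightarrow> (nat \<times> (nat \<Rightarrow> real) \<Rightarrow> 'b) \<Rightarrow> bool" where
  "hhom Y y \<equiv> homotopic_with (\<lambda>h. h hbase = y) hinf_top Y"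

lemma cube_rep_outside: "s \<notin> open_cube n \<Longrightarrow> cube_rep f n k s = f hbase"
  by (simp add: cube_rep_def cube_to_sphere_outside)

lemma hemb_inside:
  assumes "k \<ge> 1" "s \<in> open_cube n"
  shows "hemb n (cube_to_sphere n k s) = (n, cube_to_sphere n k s)"
  using cube_to_sphere_neq_origin[OF assms(2,1)] by (simp add: hemb_def)

lemma hemb_inside_neq_hbase:
  assumes "k \<ge> 1" "s \<in> open_cube n"
  shows "hemb n (cube_to_sphere n k s) \<noteq> hbase"
  using cube_to_sphere_neq_origin[OF assms(2,1)] by simp

lemma sphere_index_cube_to_sphere:
  assumes "k \<ge> 1" "s \<in> open_cube n"
  shows "sphere_index n (cube_to_sphere n k s) = k"
  by (rule sphere_index_eq[OF cube_to_sphere_in_hsphere cube_to_sphere_neq_origin(2)[OF assms(2,1)] assms(1)])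

lemma cube_rep_of_cubes:
  assumes "k \<ge> 1" "s \<in> open_cube n"
  shows "cube_rep (of_cubes y A) n k s = A n k s"
  using hemb_inside_neq_hbase[OF assms]
  by (simp add: cube_rep_def of_cubes_def hemb_inside[OF assms] sphere_index_cube_to_sphere[OF assms] sphere_to_cube_inverse[OF assms(2,1)])

lemma of_cubes_hbase [simp]: "of_cubes y A hbase = y"
  by (simp add: of_cubes_def)

lemma hinf_set_cubeE:
  assumes "p \<in> hinf_set" "p \<noteq> hbase"
  obtains n k s where "n \<ge> 1" "k \<ge> 1" "s \<in> open_cube n" "p = hemb n (cube_to_sphere n k s)"
proof -
  obtain n k r where r: "n \<ge> 1" "k \<ge> 1" "r \<in> hsphere n k" "p = hemb n r"
    using assms(1) by (rule hinf_setE)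
  then have "r \<noteq> origin" using assms(2) by auto
  then have "cube_to_sphere n k (sphere_to_cube n r) = r" using cube_to_sphere_inverse r by blast
  then show ?thesis using that[OF r(1,2) sphere_to_cube_in_open_cube[of n r]] r(4) by simp
qed

abbreviation I01 :: "real topology" where "I01 \<equiv> top_of_set {0..1}"

lemma prod_top_of_set: "prod_topology (top_of_set S) (top_of_set T) = top_of_set (S \<times> T)"
  by (simp add: prod_topology_subtopology subtopology_subtopology Times_Int_Times)

text \<open>The product of a quotient map with an identity map is again a quotient map when the
  other factor is locally compact, as [0, 1] is. Hence homotopies on a sphere can be tested on the
  cube.\<close>

lemma continuous_map_from_cube:
  assumes "n \<ge> 1" "k \<ge> 1"
    and "continuous_map (prod_topology I01 (top_of_set (closed_cube n))) Y (\<lambda>(u, s). h (u, cube_to_sphere n k s))"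
  shows "continuous_map (prod_topology I01 (top_of_set (hsphere n k))) Y h"
proof -
  have lc: "locally_compact_space I01"
    by (intro compact_imp_locally_compact_space compact_space_subtopology) auto
  have hd: "Hausdorff_space I01 \<or> regular_space I01" by (simp add: Hausdorff_space_subtopology)
  have "quotient_map (prod_topology I01 (top_of_set (closed_cube n))) (prod_topology I01 (top_of_set (hsphere n k)))
     (\<lambda>(u, s). (u, cube_to_sphere n k s))"
    by (rule quotient_map_prod_right[OF lc hd quotient_map_cube_to_sphere[OF assms(1,2)]])
  then show ?thesis
    by (rule continuous_compose_quotient_map) (use assms(3) in \<open>simp add: o_def case_prod_unfold\<close>)
qed

text \<open>The boundary values make the family descend to the spheres, and smallness glues the
  spheres at the base point. This is the tool behind reparametrizations, products and sphere-wise
  homotopies.\<close>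

lemma hhom_of_cubes:
  assumes cont: "\<And>n k. n \<ge> 1 \<Longrightarrow> k \<ge> 1 \<Longrightarrow>
      continuous_map (prod_topology I01 (top_of_set (closed_cube n))) Y (\<lambda>(u, s). A u n k s)"
    and bd: "\<And>n k u s. n \<ge> 1 \<Longrightarrow> k \<ge> 1 \<Longrightarrow> u \<in> {0..1} \<Longrightarrow> s \<in> closed_cube n \<Longrightarrow> s \<notin> open_cube n \<Longrightarrow> A u n k s = y"
    and small: "null_family Y y (\<lambda>n k. (\<lambda>(u, s). A u n k s) ` ({0..1} \<times> open_cube n))"
    and f: "f hbase = y" "\<And>n k s. n \<ge> 1 \<Longrightarrow> k \<ge> 1 \<Longrightarrow> s \<in> open_cube n \<Longrightarrow> cube_rep f n k s = A 0 n k s"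
    and g: "g hbase = y" "\<And>n k s. n \<ge> 1 \<Longrightarrow> k \<ge> 1 \<Longrightarrow> s \<in> open_cube n \<Longrightarrow> cube_rep g n k s = A 1 n k s"
  shows "hhom Y y f g"
proof -
  define F where "F x = of_cubes y (A (fst x)) (snd x)" for x :: "real \<times> nat \<times> (nat \<Rightarrow> real)"
  have Fin: "F (u, hemb n (cube_to_sphere n k s)) = A u n k s" if "k \<ge> 1" "s \<in> open_cube n" for u n k s
    using cube_rep_of_cubes[OF that, of y "A u"] by (simp add: F_def cube_rep_def)
  have Fb: "F (u, hbase) = y" for u by (simp add: F_def)
  have Fc: "F (u, hemb n (cube_to_sphere n k s)) = A u n k s"
    if "n \<ge> 1" "k \<ge> 1" "u \<in> {0..1}" "s \<in> closed_cube n" for u n k s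
  proof (cases "s \<in> open_cube n")
    case False
    then show ?thesis using bd[OF that False] by (simp add: cube_to_sphere_outside Fb)
  qed (use Fin that in simp)
  have "continuous_map (prod_topology I01 hinf_top) Y F"
  proof (rule continuous_map_prod_hinf)
    fix n k :: nat assume nk: "n \<ge> 1" "k \<ge> 1"
    show "continuous_map (prod_topology I01 (top_of_set (hsphere n k))) Y (\<lambda>(u, r). F (u, hemb n r))"
    proof (rule continuous_map_from_cube[OF nk])
      show "continuous_map (prod_topology I01 (top_of_set (closed_cube n))) Y
         (\<lambda>(u, s). case (u, cube_to_sphere n k s) of (u, r) \<Rightarrow> F (u, hemb n r))"
        by (rule continuous_map_eq[OF cont[OF nk]]) (use Fc[OF nk] in auto)
    qed
  next
    show "null_family Y y (\<lambda>n k. (\<lambda>(u, r). F (u, hemb n r)) ` (topspace I01 \<times> hsphere n k))"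
    proof (rule null_family_subset1[OF small], rule image_subsetI)
      fix n k :: nat and x assume nk: "n \<ge> 1" "k \<ge> 1" and "x \<in> topspace I01 \<times> hsphere n k"
      then obtain u r where x: "x = (u, r)" and u: "u \<in> {0..1}" and r: "r \<in> hsphere n k" by auto
      have "F (u, hemb n r) \<in> insert y ((\<lambda>(u, s). A u n k s) ` ({0..1} \<times> open_cube n))"
      proof (cases "r = origin")
        case True
        then show ?thesis by (simp add: Fb)
      next
        case False
        have "F (u, hemb n r) = A u n k (sphere_to_cube n r)"
          using Fin[OF nk(2) sphere_to_cube_in_open_cube, of u n r] cube_to_sphere_inverse[OF r False nk(2)] by simp
        moreover have "(u, sphere_to_cube n r) \<in> {0..1} \<times> open_cube n" using u sphere_to_cube_in_open_cube[of n r] by simp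
        ultimately show ?thesis by (intro insertI2 image_eqI[of _ _ "(u, sphere_to_cube n r)"]) simp_all
      qed
      then show "(case x of (u, r) \<Rightarrow> F (u, hemb n r)) \<in> insert y ((\<lambda>(u, s). A u n k s) ` ({0..1} \<times> open_cube n))"
        by (simp only: x case_prod_conv)
    qed
  qed (rule Fb)
  moreover have "F (0, p) = f p" if "p \<in> hinf_set" for p
  proof (cases "p = hbase")
    case False
    with that obtain n k s where "n \<ge> 1" "k \<ge> 1" "s \<in> open_cube n" "p = hemb n (cube_to_sphere n k s)"
      by (rule hinf_set_cubeE)
    then show ?thesis using Fin[of k s n 0] f(2)[of n k s] by (simp add: cube_rep_def)
  qed (simp add: Fb f)
  moreover have "F (1, p) = g p" if "p \<in> hinf_set" for p
  proof (cases "p = hbase")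
    case False
    with that obtain n k s where "n \<ge> 1" "k \<ge> 1" "s \<in> open_cube n" "p = hemb n (cube_to_sphere n k s)"
      by (rule hinf_set_cubeE)
    then show ?thesis using Fin[of k s n 1] g(2)[of n k s] by (simp add: cube_rep_def)
  qed (simp add: Fb g)
  ultimately show ?thesis
    \<comment> \<open>\<open>F\<close> matches \<open>f\<close> and \<open>g\<close> only on
      \<open>hinf_set\<close>, which suffices because the base point condition depends only on
      values there.\<close>
    by (subst homotopic_with) (auto intro!: exI[of _ F] simp: Fb)
qed

lemma hhom_imp_based:
  assumes "hhom Y y f g"
  shows "f \<in> based_maps Y y" "g \<in> based_maps Y y"
  using homotopic_with_imp_continuous_maps[OF assms] homotopic_with_imp_property[OF assms]
  by (auto simp: based_maps_def)

lemma hhom_refl: "f \<in> based_maps Y y \<Longrightarrow> hhom Y y f f"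
  by (simp add: based_maps_def)

lemma hhomE:
  assumes "hhom Y y f g"
  obtains F where "continuous_map (prod_topology I01 hinf_top) Y F"
    "\<And>p. F (0, p) = f p" "\<And>p. F (1, p) = g p" "\<And>u. u \<in> {0..1} \<Longrightarrow> F (u, hbase) = y"
  using assms unfolding homotopic_with_def by auto

section \<open>Cube representatives of homotopies and reparametrization of the first
  coordinate\<close>

definition hrep :: "(real \<times> nat \<times> (nat \<Rightarrow> real) \<Rightarrow> 'b) \<Rightarrow> real \<Rightarrow> nat \<Rightarrow> nat \<Rightarrow> (nat \<Rightarrow> real) \<Rightarrow> 'b" where
  "hrep F u = cube_rep (\<lambda>p. F (u, p))"

lemma hrep_outside: "s \<notin> open_cube n \<Longrightarrow> hrep F u n k s = F (u, hbase)"
  by (simp add: hrep_def cube_rep_outside)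

lemma continuous_map_hrep:
  assumes "continuous_map (prod_topology I01 hinf_top) Y F" "n \<ge> 1" "k \<ge> 1"
  shows "continuous_map (prod_topology I01 (top_of_set (coord_space n))) Y (\<lambda>(u, s). hrep F u n k s)"
proof -
  have "continuous_map (top_of_set (coord_space n)) (top_of_set (hsphere n k)) (cube_to_sphere n k)"
    using continuous_on_cube_to_sphere[OF assms(2)] cube_to_sphere_in_hsphere by auto
  then have "continuous_map (prod_topology I01 (top_of_set (coord_space n))) (prod_topology I01 (top_of_set (hsphere n k)))
    (\<lambda>x. (fst x, cube_to_sphere n k (snd x)))"
    by (intro continuous_map_pairedI continuous_map_fst continuous_map_compose[OF continuous_map_snd, unfolded o_def])
  from continuous_map_compose[OF this continuous_map_prod_hinfD[OF assms]]
  show ?thesis by (simp add: o_def case_prod_unfold hrep_def cube_rep_def)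
qed

lemma null_family_hrep:
  assumes "continuous_map (prod_topology I01 hinf_top) Y F" "\<And>u. u \<in> {0..1} \<Longrightarrow> F (u, hbase) = y"
  shows "null_family Y y (\<lambda>n k. (\<lambda>(u, s). hrep F u n k s) ` ({0..1} \<times> UNIV))"
proof -
  have 0: "null_family Y y (\<lambda>n k. (\<lambda>(u, r). F (u, hemb n r)) ` (topspace I01 \<times> hsphere n k))"
    by (rule null_family_homotopy[OF assms(1)]) (auto simp: assms compact_space_subtopology)
  have "(\<lambda>(u, s). hrep F u n k s) ` ({0..1} \<times> UNIV) \<subseteq> (\<lambda>(u, r). F (u, hemb n r)) ` (topspace I01 \<times> hsphere n k)" for n k
    using cube_to_sphere_in_hsphere by (auto simp: hrep_def cube_rep_def)
  then show ?thesis by (intro null_family_subset1[OF 0] subset_insertI2)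
qed

lemma continuous_map_reparam:
  assumes "n \<ge> 1" "continuous_on ({0..1} \<times> UNIV) (\<lambda>(u, x). \<psi> u x)"
  shows "continuous_map (prod_topology I01 (top_of_set (closed_cube n))) (prod_topology I01 (top_of_set (coord_space n)))
     (\<lambda>(u, s). (u, s(1 := \<psi> u (s 1))))"
proof -
  let ?T = "{0..1} \<times> closed_cube n :: (real \<times> (nat \<Rightarrow> real)) set"
  have cs: "continuous_on ?T (\<lambda>x. snd x i)" for i
    by (rule continuous_on_compose2[OF continuous_on_coordinate[of UNIV i] continuous_on_snd[OF continuous_on_id]]) simp
  have "continuous_on ?T (\<lambda>x. (fst x, snd x 1))"
    by (intro continuous_on_Pair continuous_on_fst continuous_on_id cs)
  moreover have "(\<lambda>x. (fst x, snd x 1)) ` ?T \<subseteq> {0..1} \<times> UNIV" by auto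
  ultimately have c1: "continuous_on ?T (\<lambda>x. \<psi> (fst x) (snd x 1))"
    using continuous_on_compose2[OF assms(2)] by fastforce
  have "continuous_on ?T (\<lambda>x. ((snd x)(1 := \<psi> (fst x) (snd x 1))) i)" for i
    using c1 cs[of i] by (cases "i = 1") simp_all
  then have "continuous_on ?T (\<lambda>x. (snd x)(1 := \<psi> (fst x) (snd x 1)))"
    by (rule continuous_on_coordinatewise_then_product)
  then have "continuous_on ({0..1} \<times> closed_cube n) (\<lambda>x. (fst x, (snd x)(1 := \<psi> (fst x) (snd x 1))))"
    by (intro continuous_on_Pair continuous_on_fst continuous_on_id)
  then show ?thesis using assms(1)
    unfolding prod_top_of_set case_prod_unfold
    by (intro continuous_map_into_subtopology) (auto simp: closed_cube_def coord_space_def)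
qed

lemma open_cube_updD:
  assumes "s(1 := a) \<in> open_cube n" "n \<ge> 1"
  shows "0 < a" "a < 1" "0 < s 1 \<Longrightarrow> s 1 < 1 \<Longrightarrow> s \<in> open_cube n"
proof -
  have *: "\<And>i. 1 \<le> i \<Longrightarrow> i \<le> n \<Longrightarrow> 0 < (s(1 := a)) i \<and> (s(1 := a)) i < 1"
    "\<And>i. \<not> (1 \<le> i \<and> i \<le> n) \<Longrightarrow> (s(1 := a)) i = 0"
    using assms(1) unfolding open_cube_def by blast+
  show "0 < a" "a < 1" using *(1)[of 1] assms(2) by simp_all
  assume s1: "0 < s 1" "s 1 < 1"
  have "0 < s i \<and> s i < 1" if "1 \<le> i" "i \<le> n" for i
    using *(1)[OF that] s1 by (cases "i = 1") auto
  moreover have "s i = 0" if "\<not> (1 \<le> i \<and> i \<le> n)" for i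
    using *(2)[OF that] that assms(2) by (cases "i = 1") auto
  ultimately show "s \<in> open_cube n" unfolding open_cube_def by blast
qed

text \<open>A failure in another coordinate is not repaired by moving the first one, and a failure
  in the first persists by the last hypothesis. So boundary points keep the base value under
  reparametrization.\<close>

lemma open_cube_upd:
  assumes "s \<notin> open_cube n" "n \<ge> 1" "s 1 \<notin> {0<..<1} \<Longrightarrow> a \<notin> {0<..<1}"
  shows "s(1 := a) \<notin> open_cube n"
proof
  assume "s(1 := a) \<in> open_cube n"
  note this open_cube_updD[OF this assms(2)]
  then show False using assms by auto
qed

text \<open>Since the cube representative of a based map is constant outside the open cube, a
  reparametrization may leave the unit interval; this one lemma yields the unit laws,
  associativity and inverses.\<close>

lemma hhom_reparam:
  fixes \<psi> :: "real \<Rightarrow> real \<Rightarrow> real"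
  assumes f: "f \<in> based_maps Y y"
    and \<psi>: "continuous_on ({0..1} \<times> UNIV) (\<lambda>(u, x). \<psi> u x)"
      "\<And>u x. u \<in> {0..1} \<Longrightarrow> x \<notin> {0<..<1} \<Longrightarrow> \<psi> u x \<notin> {0<..<1::real}"
    and g: "g hbase = y" "\<And>n k s. n \<ge> 1 \<Longrightarrow> k \<ge> 1 \<Longrightarrow> s \<in> open_cube n \<Longrightarrow> cube_rep g n k s = cube_rep f n k (s(1 := \<psi> 0 (s 1)))"
    and h: "h hbase = y" "\<And>n k s. n \<ge> 1 \<Longrightarrow> k \<ge> 1 \<Longrightarrow> s \<in> open_cube n \<Longrightarrow> cube_rep h n k s = cube_rep f n k (s(1 := \<psi> 1 (s 1)))"
  shows "hhom Y y g h"
proof -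
  obtain F where F: "continuous_map (prod_topology I01 hinf_top) Y F"
    "\<And>u. u \<in> {0..1} \<Longrightarrow> F (u, hbase) = y" "\<And>u. hrep F u = cube_rep f"
  proof
    \<comment> \<open>The constant homotopy at \<open>f\<close>, so that the results on homotopies
      apply to a single map.\<close>
    show "continuous_map (prod_topology I01 hinf_top) Y (f \<circ> snd)"
      using f by (intro continuous_map_compose[OF continuous_map_snd]) (simp add: based_maps_def)
    show "(f \<circ> snd) (u, hbase) = y" for u :: real using f by (simp add: based_maps_def)
    show "hrep (f \<circ> snd) u = cube_rep f" for u by (simp add: hrep_def)
  qed
  define A where "A u n k s = cube_rep f n k (s(1 := \<psi> u (s 1)))" for u :: real and n k s
  show ?thesis
  proof (rule hhom_of_cubes[of _ A])
    fix n k :: nat assume nk: "n \<ge> 1" "k \<ge> 1"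
    show "continuous_map (prod_topology I01 (top_of_set (closed_cube n))) Y (\<lambda>(u, s). A u n k s)"
      using continuous_map_compose[OF continuous_map_reparam[OF nk(1) \<psi>(1)] continuous_map_hrep[OF F(1) nk]]
      by (simp add: o_def case_prod_unfold F(3) A_def)
  next
    fix n k :: nat and u :: real and s assume "n \<ge> 1" "u \<in> {0..1}" "s \<in> closed_cube n" "s \<notin> open_cube n"
    then have "s(1 := \<psi> u (s 1)) \<notin> open_cube n" by (intro open_cube_upd \<psi>(2))
    then show "A u n k s = y" using f by (simp add: A_def cube_rep_outside based_maps_def)
  next
    have 0: "null_family Y y (\<lambda>n k. (\<lambda>(u, s). hrep F u n k s) ` ({0..1} \<times> UNIV))"
      by (rule null_family_hrep[OF F(1,2)])
    have "(\<lambda>(u, s). A u n k s) ` ({0..1} \<times> open_cube n) \<subseteq> (\<lambda>(u, s). hrep F u n k s) ` ({0..1} \<times> UNIV)" for n k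
      by (auto simp: A_def F(3))
    then show "null_family Y y (\<lambda>n k. (\<lambda>(u, s). A u n k s) ` ({0..1} \<times> open_cube n))"
      by (intro null_family_subset1[OF 0] subset_insertI2)
  qed (use g h in \<open>auto simp: A_def\<close>)
qed

lemma hinf_mult_hbase [simp]: "hinf_mult f g hbase = f hbase"
  by (simp add: hinf_mult_def)

text \<open>Outside the open cube both sides are the common base value. The formula is thus
  available for every \<open>s\<close> and can be applied repeatedly at reparametrized
  arguments.\<close>

lemma cube_rep_hinf_mult:
  assumes nk: "n \<ge> 1" "k \<ge> 1" and fg: "f hbase = g hbase"
  shows "cube_rep (hinf_mult f g) n k s =
    (if s 1 \<le> 1/2 then cube_rep f n k (s(1 := 2 * s 1)) else cube_rep g n k (s(1 := 2 * s 1 - 1)))"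
proof (cases "s \<in> open_cube n")
  case True
  let ?x = "cube_to_sphere n k s"
  \<comment> \<open>\<open>cube_to_sphere\<close> is injective on the open cube, so the description
    in \<open>sphere_concat\<close> picks out \<open>s\<close>.\<close>
  have "(THE t. t \<in> open_cube n \<and> cube_to_sphere n k t = ?x) = s"
  proof (rule the_equality)
    fix t assume "t \<in> open_cube n \<and> cube_to_sphere n k t = ?x"
    then show "t = s" using sphere_to_cube_inverse[OF _ nk(2)] True by metis
  qed (use True in simp)
  then have "sphere_concat n k f' g' ?x = (if s 1 \<le> 1/2 then f' (cube_to_sphere n k (s(1 := 2 * s 1)))
      else g' (cube_to_sphere n k (s(1 := 2 * s 1 - 1))))" for f' g' :: "(nat \<Rightarrow> real) \<Rightarrow> 'a"
    using cube_to_sphere_in_hsphere[of n k s] cube_to_sphere_neq_origin(2)[OF True nk(2)]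
    by (simp add: sphere_concat_def)
  then show ?thesis
    using hemb_inside_neq_hbase[OF nk(2) True]
    by (simp add: cube_rep_def hinf_mult_def hemb_inside[OF nk(2) True] sphere_index_cube_to_sphere[OF nk(2) True])
next
  case False
  have "s(1 := 2 * s 1) \<notin> open_cube n" if "s 1 \<le> 1/2"
    by (rule open_cube_upd[OF False nk(1)]) (use that in auto)
  moreover have "s(1 := 2 * s 1 - 1) \<notin> open_cube n" if "\<not> s 1 \<le> 1/2"
    by (rule open_cube_upd[OF False nk(1)]) (use that in auto)
  ultimately show ?thesis using False fg by (simp add: cube_rep_outside)
qed

section \<open>The group structure\<close>


text \<open>Both homotopies run at once, each on its half of the cube. Applied to constant
  homotopies this also shows that a product of based maps is continuous.\<close>

lemma hhom_hinf_mult: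
  assumes "hhom Y y f f'" "hhom Y y g g'"
  shows "hhom Y y (hinf_mult f g) (hinf_mult f' g')"
proof -
  obtain F where F: "continuous_map (prod_topology I01 hinf_top) Y F"
    "\<And>p. F (0, p) = f p" "\<And>p. F (1, p) = f' p" "\<And>u. u \<in> {0..1} \<Longrightarrow> F (u, hbase) = y"
    using hhomE[OF assms(1)] by blast
  obtain G where G: "continuous_map (prod_topology I01 hinf_top) Y G"
    "\<And>p. G (0, p) = g p" "\<And>p. G (1, p) = g' p" "\<And>u. u \<in> {0..1} \<Longrightarrow> G (u, hbase) = y"
    using hhomE[OF assms(2)] by blast
  have ends: "hrep F 0 = cube_rep f" "hrep F 1 = cube_rep f'" "hrep G 0 = cube_rep g" "hrep G 1 = cube_rep g'"
    by (simp_all add: hrep_def F G)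
  have base: "f hbase = y" "f' hbase = y" "g hbase = y" "g' hbase = y"
    using F(4)[of 0] F(4)[of 1] G(4)[of 0] G(4)[of 1] by (simp_all add: F(2,3) G(2,3))
  define A1 where "A1 n k x = hrep F (fst x) n k ((snd x)(1 := 2 * snd x 1))" for n k and x :: "real \<times> (nat \<Rightarrow> real)"
  define A2 where "A2 n k x = hrep G (fst x) n k ((snd x)(1 := 2 * snd x 1 - 1))" for n k and x :: "real \<times> (nat \<Rightarrow> real)"
  define A where "A u n k s = (if s 1 \<le> 1/2 then A1 n k (u, s) else A2 n k (u, s))" for u n k s
  show ?thesis
  proof (rule hhom_of_cubes[of _ A])
    fix n k :: nat assume nk: "n \<ge> 1" "k \<ge> 1"
    let ?X = "prod_topology I01 (top_of_set (closed_cube n))"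
    have c1: "continuous_map ?X Y (A1 n k)"
      using continuous_map_compose[OF continuous_map_reparam[OF nk(1), of "\<lambda>u x. 2 * x"] continuous_map_hrep[OF F(1) nk]]
      by (simp add: A1_def[abs_def] o_def case_prod_unfold continuous_on_mult_left continuous_on_snd)
    have c2: "continuous_map ?X Y (A2 n k)"
      using continuous_map_compose[OF continuous_map_reparam[OF nk(1), of "\<lambda>u x. 2 * x - 1"] continuous_map_hrep[OF G(1) nk]]
      by (simp add: A2_def[abs_def] o_def case_prod_unfold continuous_on_mult_left continuous_on_snd continuous_on_diff)
    have p: "continuous_map ?X euclideanreal (\<lambda>x. snd x 1)"
      unfolding prod_top_of_set continuous_map_iff_continuous
      by (rule continuous_on_compose2[OF continuous_on_coordinate[of UNIV 1] continuous_on_snd[OF continuous_on_id]]) simp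
    have "continuous_map ?X Y (\<lambda>x. if snd x 1 \<le> 1/2 then A1 n k x else A2 n k x)"
    proof (rule continuous_map_cases_le[OF p])
      fix x assume x: "x \<in> topspace ?X" "snd x 1 = 1/2"
      then have u: "fst x \<in> {0..1}" by auto
      \<comment> \<open>At 1/2 the new first coordinates are 1 and 0, outside the open cube, where
        both homotopies take the base value.\<close>
      have "(snd x)(1 := 2 * snd x 1) \<notin> open_cube n" "(snd x)(1 := 2 * snd x 1 - 1) \<notin> open_cube n"
        using open_cube_updD(1,2)[OF _ nk(1)] x(2) by fastforce+
      then show "A1 n k x = A2 n k x"
        by (simp add: A1_def A2_def hrep_outside F(4)[OF u] G(4)[OF u])
    qed (rule continuous_map_const[THEN iffD2], simp, rule continuous_map_from_subtopology[OF c1], rule continuous_map_from_subtopology[OF c2])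
    then show "continuous_map ?X Y (\<lambda>(u, s). A u n k s)"
      by (simp only: A_def case_prod_unfold prod.collapse)
  next
    fix n k :: nat and u :: real and s assume n: "n \<ge> 1" and u: "u \<in> {0..1}" and s: "s \<notin> open_cube n"
    have "s(1 := 2 * s 1) \<notin> open_cube n" if "s 1 \<le> 1/2"
      by (rule open_cube_upd[OF s n]) (use that in auto)
    moreover have "s(1 := 2 * s 1 - 1) \<notin> open_cube n" if "\<not> s 1 \<le> 1/2"
      by (rule open_cube_upd[OF s n]) (use that in auto)
    ultimately show "A u n k s = y"
      by (simp add: A_def A1_def A2_def hrep_outside F(4)[OF u] G(4)[OF u])
  next
    have "(\<lambda>(u, s). A u n k s) ` ({0..1} \<times> open_cube n) \<subseteq>
      insert y ((\<lambda>(u, s). hrep F u n k s) ` ({0..1} \<times> UNIV) \<union> (\<lambda>(u, s). hrep G u n k s) ` ({0..1} \<times> UNIV))" for n k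
    proof (rule image_subsetI)
      fix x assume "x \<in> {0..1::real} \<times> open_cube n"
      then obtain u s where x: "x = (u, s)" "u \<in> {0..1}" by auto
      have "hrep F u n k t \<in> (\<lambda>(u, s). hrep F u n k s) ` ({0..1} \<times> UNIV)"
        "hrep G u n k t \<in> (\<lambda>(u, s). hrep G u n k s) ` ({0..1} \<times> UNIV)" for t
        by (rule image_eqI[of _ _ "(u, t)"]; use x in simp)+
      then show "(case x of (u, s) \<Rightarrow> A u n k s) \<in>
          insert y ((\<lambda>(u, s). hrep F u n k s) ` ({0..1} \<times> UNIV) \<union> (\<lambda>(u, s). hrep G u n k s) ` ({0..1} \<times> UNIV))"
        by (simp add: x A_def A1_def A2_def)
    qed
    then show "null_family Y y (\<lambda>n k. (\<lambda>(u, s). A u n k s) ` ({0..1} \<times> open_cube n))"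
      by (intro null_family_subset[OF null_family_hrep[OF F(1,4)] null_family_hrep[OF G(1,4)]])
  qed (auto simp: base cube_rep_hinf_mult A_def A1_def A2_def ends)
qed

lemma hinf_mult_based: "f \<in> based_maps Y y \<Longrightarrow> g \<in> based_maps Y y \<Longrightarrow> hinf_mult f g \<in> based_maps Y y"
  by (rule hhom_imp_based(1)[OF hhom_hinf_mult[OF hhom_refl hhom_refl]])

lemma const_based: "y \<in> topspace Y \<Longrightarrow> (\<lambda>_. y) \<in> based_maps Y y"
  by (simp add: based_maps_def)

lemma based_maps_hbase: "f \<in> based_maps Y y \<Longrightarrow> f hbase = y"
  by (simp add: based_maps_def)

text \<open>A convex combination of two values that are both at most 0, or both at least 1, stays on
  that side. This supplies the boundary condition of \<open>hhom_reparam\<close> for straight lines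
  between reparametrizations.\<close>

lemma convex_reparam_outside:
  fixes u x a b :: real
  assumes "u \<in> {0..1}" "x \<notin> {0<..<1}" "x \<le> 0 \<Longrightarrow> a \<le> 0 \<and> b \<le> 0" "x \<ge> 1 \<Longrightarrow> a \<ge> 1 \<and> b \<ge> 1"
  shows "(1 - u) * a + u * b \<notin> {0<..<1}"
proof (cases "x \<le> 0")
  case True
  then have "(1 - u) * a \<le> 0" "u * b \<le> 0" using assms by (auto simp: mult_le_0_iff)
  then show ?thesis by auto
next
  case False
  then have "a \<ge> 1" "b \<ge> 1" using assms by auto
  then have "(1 - u) * 1 + u * 1 \<le> (1 - u) * a + u * b"
    using assms(1) by (intro add_mono mult_left_mono) auto
  then have "(1 - u) * a + u * b \<ge> 1" by (simp only: mult_1_right diff_add_cancel)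
  then show ?thesis by simp
qed

text \<open>Where the product reads the constant map, 2x - 1 is at most 0 and the representative of
  \<open>f\<close> has the base value too. So the product is \<open>f\<close> reparametrized by 2x -
  1 throughout, and this function is deformed linearly to the identity.\<close>

lemma hhom_const_mult:
  assumes f: "f \<in> based_maps Y y"
  shows "hhom Y y (hinf_mult (\<lambda>_. y) f) f"
proof (rule hhom_reparam[OF f, of "\<lambda>u x. (1 - u) * (2 * x - 1) + u * x"])
  show "continuous_on ({0..1} \<times> UNIV) (\<lambda>(u, x). (1 - u) * (2 * x - 1) + u * x :: real)"
    unfolding case_prod_unfold by (intro continuous_intros)
  show "(1 - u) * (2 * x - 1) + u * x \<notin> {0<..<1}" if "u \<in> {0..1}" "x \<notin> {0<..<1}" for u x :: real
    by (rule convex_reparam_outside[OF that]) auto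
  fix n k :: nat and s :: "nat \<Rightarrow> real" assume nk: "n \<ge> 1" "k \<ge> 1"
  have fb: "f hbase = y" by (rule based_maps_hbase[OF f])
  have "cube_rep f n k (s(1 := 2 * s 1 - 1)) = y" if "s 1 \<le> 1/2"
  proof -
    have "s(1 := 2 * s 1 - 1) \<notin> open_cube n"
      using open_cube_updD(1)[OF _ nk(1), of s "2 * s 1 - 1"] that by linarith
    then show ?thesis using cube_rep_outside[of "s(1 := 2 * s 1 - 1)" n f k] fb by metis
  qed
  moreover have "cube_rep (\<lambda>_. y) n k t = y" for t by (simp add: cube_rep_def)
  ultimately have "cube_rep (hinf_mult (\<lambda>_. y) f) n k s = cube_rep f n k (s(1 := 2 * s 1 - 1))"
    using cube_rep_hinf_mult[OF nk, of "\<lambda>_. y" f s] fb by simp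
  then show "cube_rep (hinf_mult (\<lambda>_. y) f) n k s = cube_rep f n k (s(1 := (1 - 0) * (2 * s 1 - 1) + 0 * s 1))"
    by simp
qed (use f in \<open>simp_all add: based_maps_hbase\<close>)

text \<open>The three factors end at 1/4, 1/2, 1 in the first product and at 1/2, 3/4, 1 in the
  second. The piecewise linear map taking the second subdivision to the first has slopes 1/2, 1, 2;
  being convex, it is the maximum of its three lines.\<close>

lemma hhom_mult_assoc:
  assumes f: "f \<in> based_maps Y y" and g: "g \<in> based_maps Y y" and h: "h \<in> based_maps Y y"
  shows "hhom Y y (hinf_mult (hinf_mult f g) h) (hinf_mult f (hinf_mult g h))"
proof (rule hhom_reparam[of "hinf_mult (hinf_mult f g) h" Y y
      "\<lambda>u x. (1 - u) * x + u * max (x / 2) (max (x - 1/4) (2 * x - 1))"])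
  show "hinf_mult (hinf_mult f g) h \<in> based_maps Y y" using assms by (intro hinf_mult_based)
  show "continuous_on ({0..1} \<times> UNIV) (\<lambda>(u, x). (1 - u) * x + u * max (x / 2) (max (x - 1/4) (2 * x - 1)) :: real)"
    unfolding case_prod_unfold by (intro continuous_intros) auto
  show "(1 - u) * x + u * max (x / 2) (max (x - 1/4) (2 * x - 1)) \<notin> {0<..<1}" if "u \<in> {0..1}" "x \<notin> {0<..<1}" for u x :: real
    by (rule convex_reparam_outside[OF that]) auto
  fix n k :: nat and s :: "nat \<Rightarrow> real" assume nk: "n \<ge> 1" "k \<ge> 1"
  note b = based_maps_hbase[OF f] based_maps_hbase[OF g] based_maps_hbase[OF h]
  let ?x = "s 1"
  consider "?x \<le> 1/2" | "?x > 1/2" "?x \<le> 3/4" | "?x > 3/4" by linarith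
  then have "cube_rep (hinf_mult f (hinf_mult g h)) n k s =
    cube_rep (hinf_mult (hinf_mult f g) h) n k (s(1 := max (?x / 2) (max (?x - 1/4) (2 * ?x - 1))))"
  proof cases
    case 1
    then have m: "max (?x / 2) (max (?x - 1/4) (2 * ?x - 1)) = ?x / 2" by simp
    show ?thesis unfolding m using 1 nk assms
      by (simp add: cube_rep_hinf_mult b)
  next
    case 2
    then have m: "max (?x / 2) (max (?x - 1/4) (2 * ?x - 1)) = ?x - 1/4" by simp
    \<comment> \<open>Both sides are the parameter at which \<open>g\<close> is read, in the one
      product and in the other.\<close>
    have e: "2 * (2 * ?x - 1) = 2 * (2 * (?x - 1/4)) - 1" by simp
    show ?thesis unfolding m using 2 nk assms e
      by (simp add: cube_rep_hinf_mult b)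
  next
    case 3
    then have m: "max (?x / 2) (max (?x - 1/4) (2 * ?x - 1)) = 2 * ?x - 1" by simp
    show ?thesis unfolding m using 3 nk assms
      by (simp add: cube_rep_hinf_mult b)
  qed
  then show "cube_rep (hinf_mult f (hinf_mult g h)) n k s =
    cube_rep (hinf_mult (hinf_mult f g) h) n k (s(1 := (1 - 1) * s 1 + 1 * max (s 1 / 2) (max (s 1 - 1/4) (2 * s 1 - 1))))"
    by (simp only: diff_self mult_zero_left mult_1 add_0)
qed (use assms in \<open>simp_all add: based_maps_hbase\<close>)

definition hinf_inv :: "(nat \<times> (nat \<Rightarrow> real) \<Rightarrow> 'b) \<Rightarrow> nat \<times> (nat \<Rightarrow> real) \<Rightarrow> 'b" where
  "hinf_inv f = of_cubes (f hbase) (\<lambda>n k s. cube_rep f n k (s(1 := 1 - s 1)))"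

lemma hinf_inv_hbase [simp]: "hinf_inv f hbase = f hbase"
  by (simp add: hinf_inv_def)

lemma cube_rep_hinf_inv:
  assumes "n \<ge> 1" "k \<ge> 1"
  shows "cube_rep (hinf_inv f) n k s = cube_rep f n k (s(1 := 1 - s 1))"
proof (cases "s \<in> open_cube n")
  case True
  then show ?thesis unfolding hinf_inv_def using assms by (simp add: cube_rep_of_cubes)
next
  case False
  have "s(1 := 1 - s 1) \<notin> open_cube n" by (rule open_cube_upd[OF False assms(1)]) auto
  then show ?thesis using False by (simp add: cube_rep_outside)
qed

text \<open>A homotopy from a map to itself contains its continuity, so \<open>hhom_reparam\<close>
  is applied with a reparametrization independent of \<open>u\<close>.\<close>

lemma hinf_inv_based:
  assumes f: "f \<in> based_maps Y y"
  shows "hinf_inv f \<in> based_maps Y y"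
proof -
  have "hhom Y y (hinf_inv f) (hinf_inv f)"
  proof (rule hhom_reparam[OF f, of "\<lambda>u x. 1 - x"])
    show "continuous_on ({0..1} \<times> UNIV) (\<lambda>(u, x). 1 - x :: real)"
      unfolding case_prod_unfold by (intro continuous_intros)
  qed (use f in \<open>auto simp: based_maps_hbase cube_rep_hinf_inv\<close>)
  then show ?thesis by (rule hhom_imp_based)
qed

text \<open>The product reads \<open>f\<close> at 1 - 2x and then at 2x - 1, that is, at the
  absolute value of 2x - 1. Adding \<open>u\<close> pushes this parameter out of the cube: at
  \<open>u = 1\<close> it is at least 1 everywhere, where only the base value is taken.\<close>

lemma hhom_inv_mult:
  assumes f: "f \<in> based_maps Y y"
  shows "hhom Y y (hinf_mult (hinf_inv f) f) (\<lambda>_. y)"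
proof (rule hhom_reparam[OF f, of "\<lambda>u x. \<bar>2 * x - 1\<bar> + u"])
  show "continuous_on ({0..1} \<times> UNIV) (\<lambda>(u, x). \<bar>2 * x - 1\<bar> + u :: real)"
    unfolding case_prod_unfold by (intro continuous_intros)
  fix n k :: nat and s :: "nat \<Rightarrow> real" assume nk: "n \<ge> 1" "k \<ge> 1"
  show "cube_rep (hinf_mult (hinf_inv f) f) n k s = cube_rep f n k (s(1 := \<bar>2 * s 1 - 1\<bar> + 0))"
    using nk by (simp add: cube_rep_hinf_mult cube_rep_hinf_inv)
  have "s(1 := \<bar>2 * s 1 - 1\<bar> + 1) \<notin> open_cube n"
    using open_cube_updD(2)[OF _ nk(1), of s "\<bar>2 * s 1 - 1\<bar> + 1"] by linarith
  then show "cube_rep (\<lambda>_. y) n k s = cube_rep f n k (s(1 := \<bar>2 * s 1 - 1\<bar> + 1))"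
    using f by (simp add: cube_rep_outside based_maps_hbase) (simp add: cube_rep_def)
qed (use f in \<open>auto simp: based_maps_hbase\<close>)

section \<open>Homotopy classes and the group axioms\<close>

lemma hclass_eq_iff:
  assumes "f \<in> based_maps Y y" "g \<in> based_maps Y y"
  shows "hclass Y y f = hclass Y y g \<longleftrightarrow> hhom Y y f g"
proof
  assume "hclass Y y f = hclass Y y g"
  moreover have "g \<in> hclass Y y g" using hhom_refl[OF assms(2)] assms(2) by (simp add: hclass_def)
  ultimately have "g \<in> hclass Y y f" by simp
  then show "hhom Y y f g" by (simp add: hclass_def)
next
  assume fg: "hhom Y y f g"
  have "hhom Y y f h \<longleftrightarrow> hhom Y y g h" for h
    using fg homotopic_with_symD homotopic_with_trans by metis
  then show "hclass Y y f = hclass Y y g" by (simp add: hclass_def)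
qed

lemma hhom_some_hclass:
  assumes "f \<in> based_maps Y y"
  shows "(SOME h. h \<in> hclass Y y f) \<in> based_maps Y y" "hhom Y y f (SOME h. h \<in> hclass Y y f)"
proof -
  have "f \<in> hclass Y y f" using hhom_refl[OF assms] assms by (simp add: hclass_def)
  then have "(SOME h. h \<in> hclass Y y f) \<in> hclass Y y f" by (rule someI[of "\<lambda>h. h \<in> hclass Y y f"])
  then show "(SOME h. h \<in> hclass Y y f) \<in> based_maps Y y" "hhom Y y f (SOME h. h \<in> hclass Y y f)"
    by (simp_all add: hclass_def)
qed

lemma Hinf_group_simps:
  "carrier (Hinf_group Y y) = hclass Y y ` based_maps Y y"
  "\<one>\<^bsub>Hinf_group Y y\<^esub> = hclass Y y (\<lambda>_. y)"
  by (simp_all add: Hinf_group_def)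

text \<open>The operation chooses representatives with \<open>SOME\<close>; homotopy invariance of
  \<open>hinf_mult\<close> removes the choice.\<close>

lemma Hinf_group_mult:
  assumes "f \<in> based_maps Y y" "g \<in> based_maps Y y"
  shows "hclass Y y f \<otimes>\<^bsub>Hinf_group Y y\<^esub> hclass Y y g = hclass Y y (hinf_mult f g)"
proof -
  note a = hhom_some_hclass[OF assms(1)] and b = hhom_some_hclass[OF assms(2)]
  have "hhom Y y (hinf_mult (SOME h. h \<in> hclass Y y f) (SOME h. h \<in> hclass Y y g)) (hinf_mult f g)"
    by (rule homotopic_with_symD[OF hhom_hinf_mult[OF a(2) b(2)]])
  then show ?thesis
    using hclass_eq_iff[OF hinf_mult_based[OF a(1) b(1)] hinf_mult_based[OF assms]]
    by (simp add: Hinf_group_def)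
qed

lemma group_Hinf_group:
  assumes y: "y \<in> topspace Y"
  shows "group (Hinf_group Y y)"
proof (rule groupI)
  let ?G = "Hinf_group Y y"
  note c = const_based[OF y]
  show "\<one>\<^bsub>?G\<^esub> \<in> carrier ?G" using c by (simp add: Hinf_group_simps)
  fix A assume "A \<in> carrier ?G"
  then obtain f where f: "f \<in> based_maps Y y" "A = hclass Y y f" by (auto simp: Hinf_group_simps)
  show "\<one>\<^bsub>?G\<^esub> \<otimes>\<^bsub>?G\<^esub> A = A"
    using f c by (simp add: Hinf_group_simps Hinf_group_mult hclass_eq_iff hinf_mult_based hhom_const_mult)
  have "hclass Y y (hinf_inv f) \<otimes>\<^bsub>?G\<^esub> A = \<one>\<^bsub>?G\<^esub>"
    using f c by (simp add: Hinf_group_simps Hinf_group_mult hclass_eq_iff hinf_mult_based hinf_inv_based hhom_inv_mult)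
  then show "\<exists>B\<in>carrier ?G. B \<otimes>\<^bsub>?G\<^esub> A = \<one>\<^bsub>?G\<^esub>"
    using hinf_inv_based[OF f(1)] by (auto simp: Hinf_group_simps)
  fix B assume "B \<in> carrier ?G"
  then obtain g where g: "g \<in> based_maps Y y" "B = hclass Y y g" by (auto simp: Hinf_group_simps)
  show "A \<otimes>\<^bsub>?G\<^esub> B \<in> carrier ?G"
    using f g by (simp add: Hinf_group_simps Hinf_group_mult hinf_mult_based)
  fix C assume "C \<in> carrier ?G"
  then obtain h where h: "h \<in> based_maps Y y" "C = hclass Y y h" by (auto simp: Hinf_group_simps)
  show "A \<otimes>\<^bsub>?G\<^esub> B \<otimes>\<^bsub>?G\<^esub> C = A \<otimes>\<^bsub>?G\<^esub> (B \<otimes>\<^bsub>?G\<^esub> C)"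
    using f g h by (simp add: Hinf_group_mult hclass_eq_iff hinf_mult_based hhom_mult_assoc)
qed

section \<open>Maps supported on finitely many spheres\<close>


text \<open>For homotopies given on the spheres themselves; composing with
  \<open>cube_to_sphere\<close> supplies the data on cubes.\<close>

lemma hhom_spherewise:
  assumes cont: "\<And>n k. n \<ge> 1 \<Longrightarrow> k \<ge> 1 \<Longrightarrow> continuous_map (prod_topology I01 (top_of_set (hsphere n k))) Y (h n k)"
    and base: "\<And>n k u. n \<ge> 1 \<Longrightarrow> k \<ge> 1 \<Longrightarrow> u \<in> {0..1} \<Longrightarrow> h n k (u, origin) = y"
    and small: "null_family Y y (\<lambda>n k. h n k ` ({0..1} \<times> hsphere n k))"
    and f: "f hbase = y" "\<And>n k r. n \<ge> 1 \<Longrightarrow> k \<ge> 1 \<Longrightarrow> r \<in> hsphere n k \<Longrightarrow> h n k (0, r) = f (hemb n r)"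
    and g: "g hbase = y" "\<And>n k r. n \<ge> 1 \<Longrightarrow> k \<ge> 1 \<Longrightarrow> r \<in> hsphere n k \<Longrightarrow> h n k (1, r) = g (hemb n r)"
  shows "hhom Y y f g"
proof -
  define A where "A u n k s = h n k (u, cube_to_sphere n k s)" for u :: real and n k s
  show ?thesis
  proof (rule hhom_of_cubes[of _ A])
    fix n k :: nat assume nk: "n \<ge> 1" "k \<ge> 1"
    have "continuous_map (top_of_set (closed_cube n)) (top_of_set (hsphere n k)) (cube_to_sphere n k)"
      by (rule quotient_imp_continuous_map[OF quotient_map_cube_to_sphere[OF nk]])
    then have "continuous_map (prod_topology I01 (top_of_set (closed_cube n))) (prod_topology I01 (top_of_set (hsphere n k)))
      (\<lambda>x. (fst x, cube_to_sphere n k (snd x)))"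
      by (intro continuous_map_pairedI continuous_map_fst continuous_map_compose[OF continuous_map_snd, unfolded o_def])
    from continuous_map_compose[OF this cont[OF nk]]
    show "continuous_map (prod_topology I01 (top_of_set (closed_cube n))) Y (\<lambda>(u, s). A u n k s)"
      by (simp add: o_def case_prod_unfold A_def)
  next
    have "(\<lambda>(u, s). A u n k s) ` ({0..1} \<times> open_cube n) \<subseteq> h n k ` ({0..1} \<times> hsphere n k)" for n k
      using cube_to_sphere_in_hsphere by (auto simp: A_def)
    then show "null_family Y y (\<lambda>n k. (\<lambda>(u, s). A u n k s) ` ({0..1} \<times> open_cube n))"
      by (intro null_family_subset1[OF small] subset_insertI2)
  qed (use base f g cube_to_sphere_in_hsphere in \<open>simp_all add: A_def cube_rep_def cube_to_sphere_outside\<close>)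
qed

lemma based_maps_hsphere:
  assumes f: "f \<in> based_maps Y y"
  shows "n \<ge> 1 \<Longrightarrow> k \<ge> 1 \<Longrightarrow> continuous_map (top_of_set (hsphere n k)) Y (\<lambda>r. f (hemb n r))"
    and "null_family Y y (\<lambda>n k. (\<lambda>r. f (hemb n r)) ` hsphere n k)"
proof -
  have cf: "continuous_map hinf_top Y f" using f by (simp add: based_maps_def)
  show "continuous_map (top_of_set (hsphere n k)) Y (\<lambda>r. f (hemb n r))" if "n \<ge> 1" "k \<ge> 1"
    using continuous_map_compose[OF continuous_map_hemb[OF that] cf] by (simp add: o_def)
  have 1: "continuous_map (prod_topology I01 hinf_top) Y (\<lambda>x. f (snd x))"
    using continuous_map_compose[OF continuous_map_snd cf] by (simp add: o_def)
  have 2: "null_family Y y (\<lambda>n k. (\<lambda>(u, r). f (snd (u, hemb n r))) ` (topspace I01 \<times> hsphere n k))"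
    by (rule null_family_homotopy[OF 1]) (use f in \<open>auto simp: compact_space_subtopology based_maps_hbase\<close>)
  have "(\<lambda>(u::real, r). f (snd (u, hemb n r))) ` (topspace I01 \<times> hsphere n k) = (\<lambda>r. f (hemb n r)) ` hsphere n k" for n k
  proof
    show "(\<lambda>r. f (hemb n r)) ` hsphere n k \<subseteq> (\<lambda>(u::real, r). f (snd (u, hemb n r))) ` (topspace I01 \<times> hsphere n k)"
    proof (rule image_subsetI)
      fix r assume "r \<in> hsphere n k"
      then show "f (hemb n r) \<in> (\<lambda>(u::real, r). f (snd (u, hemb n r))) ` (topspace I01 \<times> hsphere n k)"
        by (intro image_eqI[of _ _ "(0, r)"]) auto
    qed
  qed auto
  with 2 show "null_family Y y (\<lambda>n k. (\<lambda>r. f (hemb n r)) ` hsphere n k)" by simp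
qed

text \<open>At \<open>hbase\<close> the value of \<open>sphere_index\<close> is unspecified, but
  both branches give \<open>y\<close> as soon as \<open>f hbase = y\<close>.\<close>

definition erase :: "'b \<Rightarrow> (nat \<times> nat) set \<Rightarrow> (nat \<times> (nat \<Rightarrow> real) \<Rightarrow> 'b) \<Rightarrow> nat \<times> (nat \<Rightarrow> real) \<Rightarrow> 'b" where
  "erase y Q f p = (if (fst p, sphere_index (fst p) (snd p)) \<in> Q then y else f p)"

lemma erase_hemb:
  assumes "n \<ge> 1" "k \<ge> 1" "r \<in> hsphere n k" "f hbase = y"
  shows "erase y Q f (hemb n r) = (if (n, k) \<in> Q then y else f (hemb n r))"
proof (cases "r = origin")
  case True
  then show ?thesis using assms(4) by (simp add: erase_def)
next
  case False
  then have "hemb n r = (n, r)" by (simp add: hemb_def)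
  then show ?thesis using sphere_index_eq[OF assms(3) False assms(2)] by (simp add: erase_def)
qed

lemma erase_hbase [simp]: "f hbase = y \<Longrightarrow> erase y Q f hbase = y"
  by (simp add: erase_def)

lemma continuous_map_prod_snd:
  "continuous_map T Y f \<Longrightarrow> continuous_map (prod_topology S T) Y (\<lambda>x. f (snd x))"
  using continuous_map_compose[OF continuous_map_snd, of T Y f S] by (simp add: o_def)

text \<open>The homotopy is constant off \<open>Q\<close>. The null homotopies on \<open>Q\<close>
  need not be small, for the values on finitely many spheres do not affect whether a family is
  null.\<close>

lemma hhom_erase:
  assumes f: "f \<in> based_maps Y y" and Q: "finite Q"
    and null: "\<And>n k. (n, k) \<in> Q \<Longrightarrow> sphere_null Y y n k f"
  shows "hhom Y y f (erase y Q f)"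
proof -
  have fb: "f hbase = y" by (rule based_maps_hbase[OF f])
  have "\<exists>h. continuous_map (prod_topology I01 (top_of_set (hsphere n k))) Y h \<and>
      (\<forall>r. h (0, r) = f (hemb n r)) \<and> (\<forall>r. h (1, r) = y) \<and> (\<forall>u\<in>{0..1}. h (u, origin) = y)"
    if "(n, k) \<in> Q" for n k
    using null[OF that] unfolding sphere_null_def homotopic_with_def by blast
  then obtain H where H: "\<And>n k. (n, k) \<in> Q \<Longrightarrow> continuous_map (prod_topology I01 (top_of_set (hsphere n k))) Y (H n k) \<and>
      (\<forall>r. H n k (0, r) = f (hemb n r)) \<and> (\<forall>r. H n k (1, r) = y) \<and> (\<forall>u\<in>{0..1}. H n k (u, origin) = y)"
    by metis
  define h where "h n k = (if (n, k) \<in> Q then H n k else (\<lambda>x. f (hemb n (snd x))))" for n k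
  show ?thesis
  proof (rule hhom_spherewise[of _ h])
    fix n k :: nat assume nk: "n \<ge> 1" "k \<ge> 1"
    show "continuous_map (prod_topology I01 (top_of_set (hsphere n k))) Y (h n k)"
      using H[of n k] continuous_map_prod_snd[OF based_maps_hsphere(1)[OF f nk]]
      by (cases "(n, k) \<in> Q") (simp_all only: h_def if_True if_False)
    show "h n k (u, origin) = y" if "u \<in> {0..1}" for u
      using H[of n k] that by (simp add: h_def fb)
    show "h n k (0, r) = f (hemb n r)" for r
      using H[of n k] by (simp add: h_def)
    show "h n k (1, r) = erase y Q f (hemb n r)" if "r \<in> hsphere n k" for r
      using H[of n k] by (simp add: h_def erase_hemb[where f = f, OF nk that fb])
  next
    show "null_family Y y (\<lambda>n k. h n k ` ({0..1} \<times> hsphere n k))"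
    proof (rule null_family_mono[OF based_maps_hsphere(2)[OF f] based_maps_hsphere(2)[OF f]])
      have "h n k ` ({0..1} \<times> hsphere n k) \<subseteq> (\<lambda>r. f (hemb n r)) ` hsphere n k" if "(n, k) \<notin> Q" for n k
        using that by (auto simp: h_def)
      then show "finite {(n, k). n \<ge> 1 \<and> k \<ge> 1 \<and> \<not> h n k ` ({0..1} \<times> hsphere n k) \<subseteq>
          insert y ((\<lambda>r. f (hemb n r)) ` hsphere n k \<union> (\<lambda>r. f (hemb n r)) ` hsphere n k)}"
        by (intro finite_subset[OF _ Q]) blast
    qed
  qed (use fb in simp_all)
qed

definition finite_support :: "'b \<Rightarrow> (nat \<times> (nat \<Rightarrow> real) \<Rightarrow> 'b) \<Rightarrow> bool" where
  "finite_support y f \<longleftrightarrow> finite {(n, k). n \<ge> 1 \<and> k \<ge> 1 \<and> (\<exists>r\<in>hsphere n k. f (hemb n r) \<noteq> y)}"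

lemma sphere_null_const:
  assumes "y \<in> topspace Y" "\<And>r. r \<in> hsphere n k \<Longrightarrow> f (hemb n r) = y"
  shows "sphere_null Y y n k f"
proof -
  have "homotopic_with (\<lambda>h. h origin = y) (top_of_set (hsphere n k)) Y (\<lambda>_. y) (\<lambda>r. f (hemb n r))"
    by (rule homotopic_with_equal) (use assms(1) assms(2)[of origin] assms(2) in auto)
  then show ?thesis unfolding sphere_null_def by (rule homotopic_with_symD)
qed

text \<open>\<open>wprod_image\<close> asks null spheres to be mapped constantly. A finitely
  supported map meets this once the null spheres in its support are erased, which does not change
  its class.\<close>

lemma wprod_image_eq:
  assumes y: "y \<in> topspace Y"
  shows "wprod_image Y y = hclass Y y ` {f \<in> based_maps Y y. finite_support y f}"
proof
  show "wprod_image Y y \<subseteq> hclass Y y ` {f \<in> based_maps Y y. finite_support y f}"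
  proof
    fix A assume "A \<in> wprod_image Y y"
    then obtain f where f: "A = hclass Y y f" "f \<in> based_maps Y y"
        "\<And>n k r. n \<ge> 1 \<Longrightarrow> k \<ge> 1 \<Longrightarrow> sphere_null Y y n k f \<Longrightarrow> r \<in> hsphere n k \<Longrightarrow> f (hemb n r) = y"
        "finite {(n, k). n \<ge> 1 \<and> k \<ge> 1 \<and> \<not> sphere_null Y y n k f}"
      unfolding wprod_image_def by blast
    have "finite_support y f"
      unfolding finite_support_def by (rule finite_subset[OF _ f(4)]) (use f(3) in auto)
    then show "A \<in> hclass Y y ` {f \<in> based_maps Y y. finite_support y f}" using f(1,2) by blast
  qed
  show "hclass Y y ` {f \<in> based_maps Y y. finite_support y f} \<subseteq> wprod_image Y y"
  proof (rule image_subsetI)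
    fix f assume "f \<in> {f \<in> based_maps Y y. finite_support y f}"
    then have f: "f \<in> based_maps Y y" and fin: "finite_support y f" by auto
    have fb: "f hbase = y" by (rule based_maps_hbase[OF f])
    define S where "S = {(n, k). n \<ge> 1 \<and> k \<ge> 1 \<and> (\<exists>r\<in>hsphere n k. f (hemb n r) \<noteq> y)}"
    define Q where "Q = {(n, k). (n, k) \<in> S \<and> sphere_null Y y n k f}"
    define g where "g = erase y Q f"
    have S: "finite S" using fin by (simp add: finite_support_def S_def)
    have Q: "finite Q" by (rule finite_subset[OF _ S]) (auto simp: Q_def)
    have fg: "hhom Y y f g" unfolding g_def by (rule hhom_erase[OF f Q]) (simp add: Q_def)
    have g: "g \<in> based_maps Y y" by (rule hhom_imp_based(2)[OF fg])
    have gval: "g (hemb n r) = (if (n, k) \<in> Q then y else f (hemb n r))" if "n \<ge> 1" "k \<ge> 1" "r \<in> hsphere n k" for n k r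
      unfolding g_def by (rule erase_hemb[where f = f, OF that fb])
    have g1: "g (hemb n r) = y" if nk: "n \<ge> 1" "k \<ge> 1" and nl: "sphere_null Y y n k g" and r: "r \<in> hsphere n k" for n k r
    proof (cases "(n, k) \<in> Q")
      case True
      then show ?thesis using gval[OF nk r] by simp
    next
      case False
      \<comment> \<open>Off \<open>Q\<close> the two maps agree on this sphere, so nullity passes
        from \<open>g\<close> to \<open>f\<close>; a null sphere outside \<open>Q\<close> lies
        outside the support \<open>S\<close>.\<close>
      have eq: "homotopic_with (\<lambda>h. h origin = y) (top_of_set (hsphere n k)) Y (\<lambda>r. f (hemb n r)) (\<lambda>r. g (hemb n r))"
        by (rule homotopic_with_equal)
          (use False gval[OF nk] based_maps_hsphere(1)[OF f nk] fb based_maps_hbase[OF g] in auto)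
      have "sphere_null Y y n k f"
        using homotopic_with_trans[OF eq nl[unfolded sphere_null_def]] by (simp add: sphere_null_def)
      then have "(n, k) \<notin> S" using False by (simp add: Q_def)
      then have "f (hemb n r) = y" using nk r unfolding S_def by blast
      then show ?thesis using gval[OF nk r] by simp
    qed
    have "sphere_null Y y n k g" if "n \<ge> 1" "k \<ge> 1" "(n, k) \<notin> S" for n k
    proof (rule sphere_null_const[OF y])
      fix r assume r: "r \<in> hsphere n k"
      then have "f (hemb n r) = y" using that unfolding S_def by blast
      then show "g (hemb n r) = y" using gval[OF that(1,2) r] by simp
    qed
    then have "finite {(n, k). n \<ge> 1 \<and> k \<ge> 1 \<and> \<not> sphere_null Y y n k g}"
      by (intro finite_subset[OF _ S]) auto
    then have "hclass Y y g \<in> wprod_image Y y"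
      unfolding wprod_image_def using g g1 by (intro imageI) simp
    then show "hclass Y y f \<in> wprod_image Y y" using hclass_eq_iff[OF f g] fg by simp
  qed
qed

section \<open>The cone is contractible\<close>


lemma quotient_map_quotient_topology: "quotient_map T (quotient_topology T q) q"
proof -
  let ?P = "\<lambda>U. U \<subseteq> q ` topspace T \<and> openin T {x \<in> topspace T. q x \<in> U}"
  have "istopology ?P"
    unfolding istopology_def
  proof (intro conjI allI impI)
    fix S U assume "?P S" "?P U"
    moreover have "{x \<in> topspace T. q x \<in> S \<inter> U} = {x \<in> topspace T. q x \<in> S} \<inter> {x \<in> topspace T. q x \<in> U}" by auto
    ultimately show "openin T {x \<in> topspace T. q x \<in> S \<inter> U}" "S \<inter> U \<subseteq> q ` topspace T" by auto
  next
    fix K assume K: "\<forall>S\<in>K. ?P S"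
    have "{x \<in> topspace T. q x \<in> \<Union>K} = (\<Union>S\<in>K. {x \<in> topspace T. q x \<in> S})" by auto
    moreover have "openin T (\<Union>S\<in>K. {x \<in> topspace T. q x \<in> S})" using K by (intro openin_Union) auto
    ultimately show "openin T {x \<in> topspace T. q x \<in> \<Union>K}" by simp
    show "\<Union>K \<subseteq> q ` topspace T" using K by blast
  qed
  then have op: "openin (quotient_topology T q) U \<longleftrightarrow> ?P U" for U
    unfolding quotient_topology_def by (subst topology_inverse') (assumption, rule refl)
  have "{x \<in> topspace T. q x \<in> q ` topspace T} = topspace T" by auto
  then have "openin (quotient_topology T q) (q ` topspace T)" using op by simp
  moreover have "topspace (quotient_topology T q) \<subseteq> q ` topspace T"
    using openin_topspace[of "quotient_topology T q"] unfolding op by (rule conjunct1)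
  ultimately have ts: "topspace (quotient_topology T q) = q ` topspace T" by (simp add: openin_subset subset_antisym)
  then show ?thesis by (auto simp: quotient_map_def op)
qed

abbreviation cyl :: "'a topology \<Rightarrow> ('a \<times> real) topology" where
  "cyl X \<equiv> prod_topology X (top_of_set {0..1})"

lemma quotient_map_cone: "quotient_map (cyl X) (cone X) cone_quot"
  unfolding cone_def by (rule quotient_map_quotient_topology)

lemma continuous_map_cone_quot: "continuous_map (cyl X) (cone X) cone_quot"
  by (rule quotient_imp_continuous_map[OF quotient_map_cone])

lemma topspace_cone: "topspace (cone X) = cone_quot ` (topspace X \<times> {0..1})"
  using quotient_map_cone[of X] by (simp add: quotient_map_def)

text \<open>The height moves linearly towards the apex, which is fixed. This contraction is not
  based, since a base point below the apex moves with it.\<close>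

definition cone_push :: "real \<times> ('a \<times> real) option \<Rightarrow> ('a \<times> real) option" where
  "cone_push x = (case snd x of None \<Rightarrow> None
     | Some p \<Rightarrow> cone_quot (fst p, snd p + fst x * (1 - snd p)))"

lemma cone_push_cone_quot: "cone_push (u, cone_quot p) = cone_quot (fst p, snd p + u * (1 - snd p))"
  by (auto simp: cone_push_def cone_quot_def)

lemma cone_push_0: "z \<in> topspace (cone X) \<Longrightarrow> cone_push (0, z) = z"
  by (auto simp: topspace_cone cone_push_cone_quot)

lemma cone_push_1: "cone_push (1, z) = None"
  by (auto simp: cone_push_def cone_quot_def split: option.split)

text \<open>On the cylinder continuity is a matter of arithmetic. It descends because the cone
  projection times the identity of the locally compact [0, 1] is still a quotient map.\<close>

lemma continuous_map_cone_push: "continuous_map (prod_topology I01 (cone X)) (cone X) cone_push"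
proof -
  have lc: "locally_compact_space I01"
    by (intro compact_imp_locally_compact_space compact_space_subtopology) auto
  have hd: "Hausdorff_space I01 \<or> regular_space I01" by (simp add: Hausdorff_space_subtopology)
  have q: "quotient_map (prod_topology I01 (cyl X)) (prod_topology I01 (cone X)) (\<lambda>(u, p). (u, cone_quot p))"
    by (rule quotient_map_prod_right[OF lc hd quotient_map_cone])
  let ?T = "prod_topology I01 (cyl X)"
  have u: "continuous_map ?T euclideanreal fst"
    by (intro continuous_map_into_fulltopology[OF continuous_map_fst])
  have sI: "continuous_map ?T I01 (\<lambda>x. snd (snd x))"
    using continuous_map_compose[OF continuous_map_snd[of I01 "cyl X"] continuous_map_snd[of X I01]] by (simp add: o_def)
  have s: "continuous_map ?T euclideanreal (\<lambda>x. snd (snd x))"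
    by (rule continuous_map_into_fulltopology[OF sI])
  have x: "continuous_map ?T X (\<lambda>x. fst (snd x))"
    using continuous_map_compose[OF continuous_map_snd[of I01 "cyl X"] continuous_map_fst[of X I01]] by (simp add: o_def)
  have v: "continuous_map ?T euclideanreal (\<lambda>x. snd (snd x) + fst x * (1 - snd (snd x)))"
    by (intro continuous_map_add continuous_map_real_mult continuous_map_diff u s) simp
  have "snd (snd x) + fst x * (1 - snd (snd x)) \<in> {0..1}" if "x \<in> topspace ?T" for x
  proof -
    have b: "0 \<le> fst x" "fst x \<le> 1" "0 \<le> snd (snd x)" "snd (snd x) \<le> 1" using that by auto
    then have "fst x * (1 - snd (snd x)) \<ge> 0" "fst x * (1 - snd (snd x)) \<le> 1 * (1 - snd (snd x))"
      by (simp, intro mult_right_mono) auto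
    then show ?thesis using b by auto
  qed
  then have "continuous_map ?T I01 (\<lambda>x. snd (snd x) + fst x * (1 - snd (snd x)))"
    by (intro continuous_map_into_subtopology v) blast
  then have "continuous_map ?T (cyl X) (\<lambda>x. (fst (snd x), snd (snd x) + fst x * (1 - snd (snd x))))"
    by (intro continuous_map_pairedI x)
  from continuous_map_compose[OF this continuous_map_cone_quot]
  have "continuous_map ?T (cone X) (cone_push \<circ> (\<lambda>(u, p). (u, cone_quot p)))"
    by (simp add: o_def case_prod_unfold cone_push_cone_quot)
  then show ?thesis by (rule continuous_compose_quotient_map[OF q])
qed

text \<open>The counterpart of \<open>hhom_of_cubes\<close> for one sphere, in the form that
  \<open>sphere_null\<close> asks for.\<close>

lemma homotopic_on_hsphere_of_cube:
  assumes nk: "n \<ge> 1" "k \<ge> 1"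
    and cont: "continuous_map (prod_topology I01 (top_of_set (closed_cube n))) Y (\<lambda>(u, s). A u s)"
    and bd: "\<And>u s. u \<in> {0..1} \<Longrightarrow> s \<in> closed_cube n \<Longrightarrow> s \<notin> open_cube n \<Longrightarrow> A u s = y"
    and p: "p origin = y" "\<And>s. s \<in> open_cube n \<Longrightarrow> p (cube_to_sphere n k s) = A 0 s"
    and q: "q origin = y" "\<And>s. s \<in> open_cube n \<Longrightarrow> q (cube_to_sphere n k s) = A 1 s"
  shows "homotopic_with (\<lambda>h. h origin = y) (top_of_set (hsphere n k)) Y p q"
proof -
  define h where "h x = (if snd x = origin then y else A (fst x) (sphere_to_cube n (snd x)))" for x :: "real \<times> (nat \<Rightarrow> real)"
  have hin: "h (u, cube_to_sphere n k s) = A u s" if "s \<in> open_cube n" for u s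
    using sphere_to_cube_inverse[OF that nk(2)] cube_to_sphere_neq_origin[OF that nk(2)] by (simp add: h_def)
  have hc: "h (u, cube_to_sphere n k s) = A u s" if "u \<in> {0..1}" "s \<in> closed_cube n" for u s
    using hin[of s u] bd[OF that] by (cases "s \<in> open_cube n") (simp_all add: cube_to_sphere_outside h_def)
  have c: "continuous_map (prod_topology I01 (top_of_set (hsphere n k))) Y h"
    by (rule continuous_map_from_cube[OF nk]) (rule continuous_map_eq[OF cont], use hc in auto)
  have ends: "h (0, r) = p r" "h (1, r) = q r" if r: "r \<in> hsphere n k" for r
  proof -
    have "h (0, r) = p r \<and> h (1, r) = q r"
    proof (cases "r = origin")
      case False
      then show ?thesis
        using p(2)[OF sphere_to_cube_in_open_cube[of n r]] q(2)[OF sphere_to_cube_in_open_cube[of n r]]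
          cube_to_sphere_inverse[OF r False nk(2)] by (simp add: h_def)
    qed (simp add: h_def p q)
    then show "h (0, r) = p r" "h (1, r) = q r" by auto
  qed
  show ?thesis
  proof (subst homotopic_with, goal_cases)
    case (1 f f')
    then show ?case using origin_in_hsphere[of n k] by auto
  next
    case 2
    show ?case using c ends by (intro exI[of _ h]) (auto simp: h_def)
  qed
qed

text \<open>The cube map is shrunk to the inner cube \<open>[1/4, 3/4]\<^sup>n\<close> while every point is pushed towards the
  apex by an amount \<open>\<beta>\<close> that is \<open>1\<close> on the inner cube and \<open>0\<close> on the boundary.  What results is the
  base point pushed by \<open>\<beta>\<close>, which is then released; the base point never moves.\<close>

lemma sphere_null_cone:
  assumes g: "g \<in> based_maps (cone X) y" and nk: "n \<ge> 1" "k \<ge> 1"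
  shows "sphere_null (cone X) y n k g"
proof -
  let ?T = "prod_topology I01 (top_of_set (closed_cube n))"
  have gb: "g hbase = y" by (rule based_maps_hbase[OF g])
  have gc: "continuous_map hinf_top (cone X) g" using g by (simp add: based_maps_def)
  have y: "y \<in> topspace (cone X)"
    using continuous_map_funspace[OF gc] gb hbase_in_hinf_set by auto
  define G where "G = cube_rep g n k"
  have Gc: "continuous_map (top_of_set (coord_space n)) (cone X) G"
  proof -
    have "continuous_map (top_of_set (coord_space n)) (top_of_set (hsphere n k)) (cube_to_sphere n k)"
      using continuous_on_cube_to_sphere[OF nk(1)] cube_to_sphere_in_hsphere by auto
    from continuous_map_compose[OF this based_maps_hsphere(1)[OF g nk]]
    show ?thesis by (simp add: G_def cube_rep_def[abs_def] o_def)
  qed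
  have Go: "G s = y" if "s \<notin> open_cube n" for s using that by (simp add: G_def cube_rep_outside gb)
  have Gt: "G s \<in> topspace (cone X)" for s
    using continuous_map_funspace[OF gc] hemb_in_hinf_set[OF nk cube_to_sphere_in_hsphere, of s]
    by (auto simp: G_def cube_rep_def)
  \<comment> \<open>Scaling by 1 + \<open>u\<close> about the centre; under \<open>S 1\<close>
    exactly the points with all coordinates in (1/4, 3/4) land in the open cube.\<close>
  define S where "S u s = (\<lambda>i. if 1 \<le> i \<and> i \<le> n then (1 + u) * (s i - 1/2) + 1/2 else 0)" for u :: real and s :: "nat \<Rightarrow> real"
  \<comment> \<open>Each factor is 0 at 0 and 1 and equals 1 on [1/4, 3/4], which matches the
    doubling \<open>S 1\<close>.\<close>
  define \<beta> where "\<beta> s = (\<Prod>i\<in>{1..n}. max 0 (min 1 (min (4 * s i) (4 - 4 * s i))))" for s :: "nat \<Rightarrow> real"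
  have \<beta>01: "\<beta> s \<in> {0..1}" for s
    unfolding \<beta>_def by (auto intro!: prod_nonneg prod_le_1)
  have \<beta>0: "\<beta> s = 0" if s: "s \<in> closed_cube n" "s \<notin> open_cube n" for s
  proof -
    obtain j where j: "1 \<le> j" "j \<le> n" "\<not> (0 < s j \<and> s j < 1)"
      using s by (auto simp: open_cube_def closed_cube_def)
    then have "max 0 (min 1 (min (4 * s j) (4 - 4 * s j))) = 0" by auto
    then show ?thesis unfolding \<beta>_def using j by (intro prod_zero bexI[of _ j]) auto
  qed
  have \<beta>1: "\<beta> s = 1" if "S 1 s \<in> open_cube n" for s
    unfolding \<beta>_def
  proof (rule prod.neutral, rule ballI)
    fix i assume i: "i \<in> {1..n}"
    then have "0 < S 1 s i \<and> S 1 s i < 1" using that by (auto simp: open_cube_def)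
    then have "1 \<le> 4 * s i" "1 \<le> 4 - 4 * s i" using i by (auto simp: S_def)
    then show "max 0 (min 1 (min (4 * s i) (4 - 4 * s i))) = 1" by simp
  qed
  have S_out: "S u s \<notin> open_cube n" if u: "u \<in> {0..1}" and s: "s \<in> closed_cube n" "s \<notin> open_cube n" for u s
  proof -
    obtain j where j: "1 \<le> j" "j \<le> n" "\<not> (0 < s j \<and> s j < 1)"
      using s by (auto simp: open_cube_def closed_cube_def)
    then have "0 \<le> s j \<and> s j \<le> 1" using s(1) by (auto simp: closed_cube_def)
    with j have "s j = 0 \<or> s j = 1" by auto
    then have "\<not> (0 < S u s j \<and> S u s j < 1)" using u j by (auto simp: S_def field_simps)
    then show ?thesis using j by (auto simp: open_cube_def)
  qed
  have S0: "S 0 s = s" if "s \<in> open_cube n" for s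
    using that by (auto simp: S_def open_cube_def)
  have cs: "continuous_on ({0..1::real} \<times> closed_cube n) (\<lambda>x. snd x i)" for i
    by (rule continuous_on_compose2[OF continuous_on_coordinate[of UNIV i] continuous_on_snd[OF continuous_on_id]]) simp
  have "continuous_on ({0..1} \<times> closed_cube n) (\<lambda>x. S (fst x) (snd x) i)" for i
    unfolding S_def by (cases "1 \<le> i \<and> i \<le> n")
      (auto intro!: continuous_on_add continuous_on_mult continuous_on_diff continuous_on_const continuous_on_fst continuous_on_id cs)
  then have "continuous_on ({0..1} \<times> closed_cube n) (\<lambda>x. S (fst x) (snd x))"
    by (rule continuous_on_coordinatewise_then_product)
  then have "continuous_map ?T (top_of_set (coord_space n)) (\<lambda>x. S (fst x) (snd x))"
    unfolding prod_top_of_set by (intro continuous_map_into_subtopology) (auto simp: coord_space_def S_def)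
  from continuous_map_compose[OF this Gc]
  have GS: "continuous_map ?T (cone X) (\<lambda>x. G (S (fst x) (snd x)))" by (simp add: o_def)
  have c\<beta>: "continuous_on ({0..1::real} \<times> closed_cube n) (\<lambda>x. \<beta> (snd x))"
    unfolding \<beta>_def
    by (intro continuous_on_prod continuous_on_max continuous_on_min continuous_on_const continuous_on_mult continuous_on_diff cs)
  have push: "continuous_map ?T (cone X) (\<lambda>x. cone_push (a (fst x) * \<beta> (snd x), F x))"
    if F: "continuous_map ?T (cone X) F" and a: "continuous_on {0..1} a" "\<And>u. u \<in> {0..1} \<Longrightarrow> a u \<in> {0..1::real}" for a F
  proof -
    have "continuous_on ({0..1} \<times> closed_cube n) (\<lambda>x. a (fst x) * \<beta> (snd x))"
      by (intro continuous_on_mult c\<beta> continuous_on_compose2[OF a(1) continuous_on_fst[OF continuous_on_id]]) auto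
    moreover have "a u * \<beta> s \<in> {0..1}" if "u \<in> {0..1}" for u s
      using a(2)[OF that] \<beta>01[of s] by (auto intro: mult_le_one)
    ultimately have "continuous_map ?T I01 (\<lambda>x. a (fst x) * \<beta> (snd x))"
      unfolding prod_top_of_set by (intro continuous_map_into_subtopology) auto
    then have "continuous_map ?T (prod_topology I01 (cone X)) (\<lambda>x. (a (fst x) * \<beta> (snd x), F x))"
      by (intro continuous_map_pairedI F)
    from continuous_map_compose[OF this continuous_map_cone_push] show ?thesis by (simp add: o_def)
  qed
  define m where "m r = (if r = origin then y else cone_push (\<beta> (sphere_to_cube n r), y))" for r
  have m: "m (cube_to_sphere n k s) = cone_push (\<beta> s, y)" if "s \<in> open_cube n" for s
    using sphere_to_cube_inverse[OF that nk(2)] cube_to_sphere_neq_origin[OF that nk(2)] by (simp add: m_def)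
  \<comment> \<open>Either \<open>S 1 s\<close> is in the open cube, so \<beta> is 1 and both sides
    are the apex, or \<open>G\<close> already has the value \<open>y\<close> there.\<close>
  have mid: "cone_push (\<beta> s, G (S 1 s)) = cone_push (\<beta> s, y)" for s
    using \<beta>1[of s] Go[of "S 1 s"] by (cases "S 1 s \<in> open_cube n") (simp_all add: cone_push_1)
  have "homotopic_with (\<lambda>h. h origin = y) (top_of_set (hsphere n k)) (cone X) (\<lambda>r. g (hemb n r)) m"
  proof (rule homotopic_on_hsphere_of_cube[OF nk, of _ "\<lambda>u s. cone_push (u * \<beta> s, G (S u s))"])
    show "continuous_map ?T (cone X) (\<lambda>(u, s). cone_push (u * \<beta> s, G (S u s)))"
      using push[OF GS, of "\<lambda>u. u"] by (simp add: case_prod_unfold continuous_on_id)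
    show "cone_push (u * \<beta> s, G (S u s)) = y" if "u \<in> {0..1}" "s \<in> closed_cube n" "s \<notin> open_cube n" for u s
      using \<beta>0[OF that(2,3)] Go[OF S_out[OF that]] cone_push_0[OF y] by simp
    show "g (hemb n (cube_to_sphere n k s)) = cone_push (0 * \<beta> s, G (S 0 s))" if "s \<in> open_cube n" for s
      using S0[OF that] cone_push_0[OF Gt] by (simp add: G_def cube_rep_def)
    show "m (cube_to_sphere n k s) = cone_push (1 * \<beta> s, G (S 1 s))" if "s \<in> open_cube n" for s
      using m[OF that] mid[of s] by simp
  qed (use gb in \<open>simp_all add: m_def\<close>)
  moreover have "homotopic_with (\<lambda>h. h origin = y) (top_of_set (hsphere n k)) (cone X) m (\<lambda>_. y)"
  proof (rule homotopic_on_hsphere_of_cube[OF nk, of _ "\<lambda>u s. cone_push ((1 - u) * \<beta> s, y)"])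
    show "continuous_map ?T (cone X) (\<lambda>(u, s). cone_push ((1 - u) * \<beta> s, y))"
      using push[of "\<lambda>_. y" "\<lambda>u. 1 - u"] y by (simp add: case_prod_unfold continuous_on_id continuous_on_diff)
    show "cone_push ((1 - u) * \<beta> s, y) = y" if "u \<in> {0..1}" "s \<in> closed_cube n" "s \<notin> open_cube n" for u s
      using \<beta>0[OF that(2,3)] cone_push_0[OF y] by simp
  qed (use m cone_push_0[OF y] in \<open>simp_all add: m_def\<close>)
  ultimately show ?thesis unfolding sphere_null_def by (rule homotopic_with_trans)
qed

section \<open>The homomorphism induced by the inclusion into the cone\<close>


definition cone_open :: "'a topology \<Rightarrow> ('a \<times> real) option set" where
  "cone_open X = topspace (cone X) - {None}"

lemma cone_quot_preimage_open:
  "{p \<in> topspace (cyl X). cone_quot p \<in> cone_open X} = {p \<in> topspace (cyl X). snd p < 1}"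
  by (auto simp: cone_open_def topspace_cone cone_quot_def)

lemma openin_cone_open: "openin (cone X) (cone_open X)"
proof -
  have "openin (cyl X) {p \<in> topspace (cyl X). snd p \<in> {..<1}}"
    by (rule openin_continuous_map_preimage[of _ euclideanreal])
      (auto intro: continuous_map_into_fulltopology[OF continuous_map_snd])
  then have "openin (cyl X) {p \<in> topspace (cyl X). cone_quot p \<in> cone_open X}"
    unfolding cone_quot_preimage_open by simp
  moreover have "cone_open X \<subseteq> topspace (cone X)" by (auto simp: cone_open_def)
  ultimately show ?thesis using quotient_map_cone[of X] unfolding quotient_map_def by blast
qed

text \<open>The cone projection remains a quotient map over an open set, and off the apex
  \<open>the\<close> inverts it. This gives continuous access to the point of \<open>X\<close> and
  to the height.\<close>

lemma continuous_map_cone_open: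
  "continuous_map (subtopology (cone X) (cone_open X)) (cyl X) the"
proof -
  have q: "quotient_map (subtopology (cyl X) {p \<in> topspace (cyl X). snd p < 1}) (subtopology (cone X) (cone_open X)) cone_quot"
    by (rule quotient_map_restriction[OF quotient_map_cone cone_quot_preimage_open]) (simp add: openin_cone_open)
  have "continuous_map (subtopology (cyl X) {p \<in> topspace (cyl X). snd p < 1}) (cyl X) (the \<circ> cone_quot)"
    by (rule continuous_map_eq[OF continuous_map_from_subtopology[OF continuous_map_id]])
      (auto simp: cone_quot_def)
  then show ?thesis by (rule continuous_compose_quotient_map[OF q])
qed

lemma continuous_map_cone_pt:
  assumes "t \<in> {0..1}"
  shows "continuous_map X (cone X) (\<lambda>x. cone_pt x t)"
proof -
  have "continuous_map X (cyl X) (\<lambda>x. (x, t))"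
    using assms by (intro continuous_map_pairedI) auto
  from continuous_map_compose[OF this continuous_map_cone_quot] show ?thesis
    by (simp add: o_def cone_pt_def)
qed

lemma hinf_mult_compose: "\<iota> \<circ> hinf_mult f g = hinf_mult (\<iota> \<circ> f) (\<iota> \<circ> g)"
  by (rule ext) (auto simp: hinf_mult_def sphere_concat_def Let_def)

lemma based_maps_compose:
  assumes "f \<in> based_maps Y y" "continuous_map Y Z \<iota>"
  shows "\<iota> \<circ> f \<in> based_maps Z (\<iota> y)"
  using assms by (auto simp: based_maps_def intro: continuous_map_compose)

lemma hhom_compose:
  assumes "hhom Y y f g" "continuous_map Y Z \<iota>"
  shows "hhom Z (\<iota> y) (\<iota> \<circ> f) (\<iota> \<circ> g)"
  by (rule homotopic_with_compose_continuous_map_left[OF assms]) simp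

lemma hhom_cong:
  assumes "f \<in> based_maps Y y" "\<And>p. p \<in> hinf_set \<Longrightarrow> f p = g p"
  shows "hhom Y y f g"
proof (rule homotopic_with_equal)
  show "g hbase = y" using assms(2)[OF hbase_in_hinf_set] based_maps_hbase[OF assms(1)] by simp
qed (use assms in \<open>auto simp: based_maps_def\<close>)

context
  fixes X :: "'a topology" and x0 :: 'a and t :: real
  assumes x0: "x0 \<in> topspace X" and t: "0 \<le> t" "t < 1"
begin

abbreviation (input) "lift \<equiv> (\<circ>) (\<lambda>x. cone_pt x t)"

lemma continuous_map_lift: "continuous_map X (cone X) (\<lambda>x. cone_pt x t)"
  using t by (intro continuous_map_cone_pt) auto

lemma the_cone_pt: "the (cone_pt x t) = (x, t)"
  using t by (simp add: cone_pt_def cone_quot_def)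

lemma cone_pt_in_open: "x \<in> topspace X \<Longrightarrow> cone_pt x t \<in> cone_open X"
  using continuous_map_funspace[OF continuous_map_lift] t
  by (auto simp: cone_open_def cone_pt_def cone_quot_def)

lemma cone_pt_in_cone: "cone_pt x0 t \<in> topspace (cone X)"
  using cone_pt_in_open[OF x0] by (simp add: cone_open_def)

lemma lift_based: "f \<in> based_maps X x0 \<Longrightarrow> lift f \<in> based_maps (cone X) (cone_pt x0 t)"
  by (rule based_maps_compose[OF _ continuous_map_lift])

text \<open>Every sphere of the support is null in the cone; being finitely many they can be erased
  together, and what is left is constant.\<close>

lemma lift_null_if_finite_support:
  assumes f: "f \<in> based_maps X x0" and fin: "finite_support x0 f"
  shows "hhom (cone X) (cone_pt x0 t) (lift f) (\<lambda>_. cone_pt x0 t)"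
proof -
  let ?y = "cone_pt x0 t"
  define Q where "Q = {(n, k). n \<ge> 1 \<and> k \<ge> 1 \<and> (\<exists>r\<in>hsphere n k. f (hemb n r) \<noteq> x0)}"
  have Q: "finite Q" using fin by (simp add: finite_support_def Q_def)
  have Q1: "n \<ge> 1" "k \<ge> 1" if "(n, k) \<in> Q" for n k using that by (auto simp: Q_def)
  note lf = lift_based[OF f]
  have 1: "hhom (cone X) ?y (lift f) (erase ?y Q (lift f))"
    by (rule hhom_erase[OF lf Q sphere_null_cone[OF lf Q1]])
  have "hhom (cone X) ?y (erase ?y Q (lift f)) (\<lambda>_. ?y)"
  proof (rule hhom_cong[OF hhom_imp_based(2)[OF 1]])
    fix p assume "p \<in> hinf_set"
    then obtain n k r where r: "n \<ge> 1" "k \<ge> 1" "r \<in> hsphere n k" "p = hemb n r" by (rule hinf_setE)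
    have "f (hemb n r) = x0" if "(n, k) \<notin> Q" using that r unfolding Q_def by blast
    then show "erase ?y Q (lift f) p = ?y"
      using erase_hemb[where f = "lift f", OF r(1-3) based_maps_hbase[OF lf]] r(4) by simp
  qed
  with 1 show ?thesis by (rule homotopic_with_trans)
qed

text \<open>A null homotopy of the lifted map stays away from the apex on all but finitely many
  spheres, where it can be projected back to \<open>X\<close>.\<close>

lemma finite_support_if_lift_null:
  assumes f: "f \<in> based_maps X x0" and h: "hhom (cone X) (cone_pt x0 t) (lift f) (\<lambda>_. cone_pt x0 t)"
  obtains g where "g \<in> based_maps X x0" "finite_support x0 g" "hhom X x0 f g"
proof -
  let ?y = "cone_pt x0 t"
  obtain F where F: "continuous_map (prod_topology I01 hinf_top) (cone X) F"
    "\<And>p. F (0, p) = lift f p" "\<And>p. F (1, p) = ?y" "\<And>u. u \<in> {0..1} \<Longrightarrow> F (u, hbase) = ?y"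
    using hhomE[OF h] by blast
  have fb: "f hbase = x0" by (rule based_maps_hbase[OF f])
  define S where "S n k = (\<lambda>(u, r). F (u, hemb n r)) ` (topspace I01 \<times> hsphere n k)" for n k
  have small: "null_family (cone X) ?y S"
    unfolding S_def[abs_def] by (rule null_family_homotopy[OF F(1)]) (auto simp: F(4) compact_space_subtopology)
  define Q where "Q = {(n, k). n \<ge> 1 \<and> k \<ge> 1 \<and> \<not> S n k \<subseteq> cone_open X}"
  have Q: "finite Q"
    using small openin_cone_open[of X] cone_pt_in_open[OF x0] by (simp add: null_family_def Q_def)
  \<comment> \<open>\<open>Q\<close> collects the spheres on which the homotopy meets the apex.
    There \<open>f\<close> is kept; all others are erased, which leaves finite support.\<close>
  define g where "g = erase x0 (- Q) f"
  have gv: "g (hemb n r) = (if (n, k) \<in> Q then f (hemb n r) else x0)" if "n \<ge> 1" "k \<ge> 1" "r \<in> hsphere n k" for n k r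
    unfolding g_def using erase_hemb[where f = f, OF that fb, of "- Q"] by simp
  define h where "h n k = (if (n, k) \<in> Q then (\<lambda>x. f (hemb n (snd x))) else (\<lambda>x. fst (the (F (fst x, hemb n (snd x))))))" for n k
  have hh: "hhom X x0 f g"
  proof (rule hhom_spherewise[of _ h])
    fix n k :: nat assume nk: "n \<ge> 1" "k \<ge> 1"
    let ?T = "prod_topology I01 (top_of_set (hsphere n k))"
    show "continuous_map ?T X (h n k)"
    proof (cases "(n, k) \<in> Q")
      case True
      then show ?thesis using continuous_map_prod_snd[OF based_maps_hsphere(1)[OF f nk], of I01]
        by (simp only: h_def if_True)
    next
      case False
      then have "S n k \<subseteq> cone_open X" using nk by (simp add: Q_def)
      then have "continuous_map ?T (subtopology (cone X) (cone_open X)) (\<lambda>(u, r). F (u, hemb n r))"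
        by (intro continuous_map_into_subtopology continuous_map_prod_hinfD[OF F(1) nk])
          (auto simp: S_def image_subset_iff)
      from continuous_map_compose[OF continuous_map_compose[OF this continuous_map_cone_open] continuous_map_fst]
      show ?thesis using False by (simp add: h_def o_def case_prod_unfold)
    qed
    show "h n k (u, origin) = x0" if "u \<in> {0..1}" for u
      using F(4)[OF that] by (simp add: h_def fb the_cone_pt)
    show "h n k (0, r) = f (hemb n r)" for r
      by (simp add: h_def F(2) the_cone_pt)
    show "h n k (1, r) = g (hemb n r)" if "r \<in> hsphere n k" for r
      using gv[OF nk that] by (simp add: h_def F(3) the_cone_pt)
  next
    show "null_family X x0 (\<lambda>n k. h n k ` ({0..1} \<times> hsphere n k))"
      unfolding null_family_def
    proof (intro allI impI)
      fix W assume W: "openin X W" "x0 \<in> W"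
      \<comment> \<open>The points off the apex whose \<open>X\<close> coordinate lies in
        \<open>W\<close>. They form a neighbourhood of the base point, so smallness in the cone
        survives the projection to \<open>X\<close>.\<close>
      define V where "V = {z \<in> topspace (subtopology (cone X) (cone_open X)). (fst \<circ> the) z \<in> W}"
      have "openin (subtopology (cone X) (cone_open X)) V"
        unfolding V_def
        by (rule openin_continuous_map_preimage[OF continuous_map_compose[OF continuous_map_cone_open continuous_map_fst] W(1)])
      then have "openin (cone X) V" by (rule openin_trans_full[OF _ openin_cone_open])
      moreover have "?y \<in> V"
        using W(2) cone_pt_in_open[OF x0] by (auto simp: V_def the_cone_pt cone_open_def)
      ultimately have "finite {(n, k). n \<ge> 1 \<and> k \<ge> 1 \<and> \<not> S n k \<subseteq> V}"
        using small by (simp add: null_family_def)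
      with Q have fin: "finite (Q \<union> {(n, k). n \<ge> 1 \<and> k \<ge> 1 \<and> \<not> S n k \<subseteq> V})" by simp
      have "h n k ` ({0..1} \<times> hsphere n k) \<subseteq> W" if "(n, k) \<notin> Q" "S n k \<subseteq> V" for n k
      proof (rule image_subsetI)
        fix x assume "x \<in> {0..1::real} \<times> hsphere n k"
        then have "F (fst x, hemb n (snd x)) \<in> S n k"
          unfolding S_def by (intro image_eqI[of _ _ x]) (auto simp: case_prod_unfold)
        then have "fst (the (F (fst x, hemb n (snd x)))) \<in> W" using that(2) by (auto simp: V_def)
        then show "h n k x \<in> W" using that(1) by (simp add: h_def)
      qed
      then show "finite {(n, k). n \<ge> 1 \<and> k \<ge> 1 \<and> \<not> h n k ` ({0..1} \<times> hsphere n k) \<subseteq> W}"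
        by (intro finite_subset[OF _ fin]) blast
    qed
  qed (use fb in \<open>simp_all add: g_def\<close>)
  have "finite_support x0 g"
    unfolding finite_support_def
  proof (rule finite_subset[OF _ Q], clarify)
    fix n k r assume "n \<ge> 1" "k \<ge> 1" "r \<in> hsphere n k" "g (hemb n r) \<noteq> x0"
    then show "(n, k) \<in> Q" using gv[of n k r] by (auto split: if_splits)
  qed
  with hhom_imp_based(2)[OF hh] show ?thesis using hh that by blast
qed

lemma lift_surj:
  assumes g: "g \<in> based_maps (cone X) (cone_pt x0 t)"
  obtains f where "f \<in> based_maps X x0" "hhom (cone X) (cone_pt x0 t) (lift f) g"
proof -
  let ?y = "cone_pt x0 t"
  have gb: "g hbase = ?y" by (rule based_maps_hbase[OF g])
  define Q where "Q = {(n, k). n \<ge> 1 \<and> k \<ge> 1 \<and> \<not> (\<lambda>r. g (hemb n r)) ` hsphere n k \<subseteq> cone_open X}"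
  have Q: "finite Q"
    using based_maps_hsphere(2)[OF g] openin_cone_open[of X] cone_pt_in_open[OF x0]
    by (simp add: null_family_def Q_def)
  have Q1: "n \<ge> 1" "k \<ge> 1" if "(n, k) \<in> Q" for n k using that by (auto simp: Q_def)
  \<comment> \<open>Once these spheres are erased the map avoids the apex everywhere and splits into
    a map to \<open>X\<close> and a height.\<close>
  define g' where "g' = erase ?y Q g"
  have 1: "hhom (cone X) ?y g g'"
    unfolding g'_def by (rule hhom_erase[OF g Q sphere_null_cone[OF g Q1]])
  note g' = hhom_imp_based(2)[OF 1]
  have g'_open: "g' p \<in> cone_open X" if p: "p \<in> hinf_set" for p
  proof -
    obtain n k r where r: "n \<ge> 1" "k \<ge> 1" "r \<in> hsphere n k" "p = hemb n r" using p by (rule hinf_setE)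
    have "g (hemb n r) \<in> cone_open X" if "(n, k) \<notin> Q" using that r unfolding Q_def by blast
    then show ?thesis
      using erase_hemb[where f = g, OF r(1-3) gb, of Q] r(4) cone_pt_in_open[OF x0] by (simp add: g'_def)
  qed
  then have "continuous_map hinf_top (subtopology (cone X) (cone_open X)) g'"
    using g' by (intro continuous_map_into_subtopology) (auto simp: based_maps_def)
  from continuous_map_compose[OF this continuous_map_cone_open]
  have c: "continuous_map hinf_top (cyl X) (\<lambda>p. the (g' p))" by (simp add: o_def)
  define f where "f p = fst (the (g' p))" for p
  have fc: "continuous_map hinf_top X f"
    using continuous_map_compose[OF c continuous_map_fst] by (simp add: o_def f_def[abs_def])
  have f: "f \<in> based_maps X x0"
    using fc based_maps_hbase[OF g'] by (simp add: based_maps_def f_def the_cone_pt)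
  let ?T = "prod_topology I01 hinf_top"
  define s where "s p = snd (the (g' p))" for p
  have sc: "continuous_map hinf_top I01 s"
    using continuous_map_compose[OF c continuous_map_snd] by (simp add: o_def s_def[abs_def])
  \<comment> \<open>The height runs linearly from \<open>t\<close> to \<open>s\<close>; as
    \<open>s hbase = t\<close>, the base point does not move.\<close>
  define F where "F x = cone_quot (f (snd x), (1 - fst x) * t + fst x * s (snd x))" for x
  have F: "continuous_map ?T (cone X) F"
  proof -
    have "continuous_map ?T euclideanreal (\<lambda>x. (1 - fst x) * t + fst x * s (snd x))"
      using continuous_map_into_fulltopology[OF continuous_map_prod_snd[OF sc]]
      by (intro continuous_map_add continuous_map_real_mult continuous_map_diff
            continuous_map_into_fulltopology[OF continuous_map_fst]) simp_all
    moreover have "(1 - u) * t + u * s p \<in> {0..1}" if "u \<in> {0..1}" "p \<in> hinf_set" for u p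
    proof -
      have "s p \<in> {0..1}" using continuous_map_funspace[OF sc] that by auto
      then have "0 \<le> (1 - u) * t" "0 \<le> u * s p" "(1 - u) * t + u * s p \<le> (1 - u) * 1 + u * 1"
        using that t by (auto intro!: add_mono mult_left_mono simp del: mult_1_right)
      then show ?thesis by simp
    qed
    ultimately have "continuous_map ?T I01 (\<lambda>x. (1 - fst x) * t + fst x * s (snd x))"
      by (intro continuous_map_into_subtopology) auto
    then have "continuous_map ?T (cyl X) (\<lambda>x. (f (snd x), (1 - fst x) * t + fst x * s (snd x)))"
      by (intro continuous_map_pairedI continuous_map_prod_snd[OF fc])
    from continuous_map_compose[OF this continuous_map_cone_quot] show ?thesis
      by (simp add: o_def F_def[abs_def])
  qed
  have sb: "s hbase = t" "f hbase = x0" using based_maps_hbase[OF g'] by (simp_all add: s_def f_def the_cone_pt)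
  have "hhom (cone X) ?y (lift f) g'"
  proof (subst homotopic_with, goal_cases)
    case (1 h k)
    then show ?case by simp
  next
    case 2
    have "F (1, p) = g' p" if "p \<in> hinf_set" for p
    proof -
      have "g' p \<in> cone_open X" using g'_open[OF that] .
      then have "g' p = cone_quot (the (g' p))"
        by (auto simp: cone_open_def topspace_cone cone_quot_def)
      then show ?thesis by (simp add: F_def f_def s_def)
    qed
    moreover have "F (u, hbase) = ?y" for u
      by (simp add: F_def sb cone_pt_def algebra_simps)
    ultimately show ?case using F
      by (intro exI[of _ F]) (auto simp: F_def cone_pt_def)
  qed
  from homotopic_with_trans[OF this homotopic_with_symD[OF 1]] show ?thesis using f that by blast
qed

section \<open>The induced homomorphism on classes, its image and its kernel\<close>

definition lift_class :: "(nat \<times> (nat \<Rightarrow> real) \<Rightarrow> 'a) set \<Rightarrow> (nat \<times> (nat \<Rightarrow> real) \<Rightarrow> ('a \<times> real) option) set" where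
  "lift_class A = hclass (cone X) (cone_pt x0 t) (lift (SOME f. f \<in> A))"

lemma lift_class_hclass:
  assumes f: "f \<in> based_maps X x0"
  shows "lift_class (hclass X x0 f) = hclass (cone X) (cone_pt x0 t) (lift f)"
proof -
  note s = hhom_some_hclass[OF f]
  show ?thesis
    unfolding lift_class_def
    using hclass_eq_iff[OF lift_based[OF f] lift_based[OF s(1)]] hhom_compose[OF s(2) continuous_map_lift] by simp
qed

lemma lift_class_group_hom:
  "group_hom (Hinf_group X x0) (Hinf_group (cone X) (cone_pt x0 t)) lift_class"
proof (intro group_hom.intro group_hom_axioms.intro homI)
  show "group (Hinf_group X x0)" by (rule group_Hinf_group[OF x0])
  show "group (Hinf_group (cone X) (cone_pt x0 t))" by (rule group_Hinf_group[OF cone_pt_in_cone])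
  fix A assume "A \<in> carrier (Hinf_group X x0)"
  then obtain f where f: "f \<in> based_maps X x0" "A = hclass X x0 f" by (auto simp: Hinf_group_simps)
  then show "lift_class A \<in> carrier (Hinf_group (cone X) (cone_pt x0 t))"
    by (simp add: lift_class_hclass Hinf_group_simps lift_based)
  fix B assume "B \<in> carrier (Hinf_group X x0)"
  then obtain g where g: "g \<in> based_maps X x0" "B = hclass X x0 g" by (auto simp: Hinf_group_simps)
  show "lift_class (A \<otimes>\<^bsub>Hinf_group X x0\<^esub> B) = lift_class A \<otimes>\<^bsub>Hinf_group (cone X) (cone_pt x0 t)\<^esub> lift_class B"
    using f g by (simp add: Hinf_group_mult hinf_mult_based lift_class_hclass lift_based hinf_mult_compose)
qed

lemma lift_class_surj:
  "lift_class ` carrier (Hinf_group X x0) = carrier (Hinf_group (cone X) (cone_pt x0 t))"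
proof
  show "lift_class ` carrier (Hinf_group X x0) \<subseteq> carrier (Hinf_group (cone X) (cone_pt x0 t))"
    using group_hom.hom_closed[OF lift_class_group_hom] by blast
  show "carrier (Hinf_group (cone X) (cone_pt x0 t)) \<subseteq> lift_class ` carrier (Hinf_group X x0)"
  proof
    fix B assume "B \<in> carrier (Hinf_group (cone X) (cone_pt x0 t))"
    then obtain g where g: "g \<in> based_maps (cone X) (cone_pt x0 t)" "B = hclass (cone X) (cone_pt x0 t) g"
      by (auto simp: Hinf_group_simps)
    obtain f where f: "f \<in> based_maps X x0" "hhom (cone X) (cone_pt x0 t) (lift f) g"
      using lift_surj[OF g(1)] by blast
    then have "B = lift_class (hclass X x0 f)"
      using hclass_eq_iff[OF lift_based[OF f(1)] g(1)] g(2) by (simp add: lift_class_hclass)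
    then show "B \<in> lift_class ` carrier (Hinf_group X x0)" using f(1) by (auto simp: Hinf_group_simps)
  qed
qed

lemma kernel_lift_class:
  "kernel (Hinf_group X x0) (Hinf_group (cone X) (cone_pt x0 t)) lift_class = wprod_image X x0"
proof -
  note c = const_based[OF cone_pt_in_cone]
  have k: "lift_class (hclass X x0 f) = \<one>\<^bsub>Hinf_group (cone X) (cone_pt x0 t)\<^esub> \<longleftrightarrow>
      hhom (cone X) (cone_pt x0 t) (lift f) (\<lambda>_. cone_pt x0 t)" if f: "f \<in> based_maps X x0" for f
    using hclass_eq_iff[OF lift_based[OF f] c] by (simp add: lift_class_hclass[OF f] Hinf_group_simps)
  show ?thesis
  proof
    show "kernel (Hinf_group X x0) (Hinf_group (cone X) (cone_pt x0 t)) lift_class \<subseteq> wprod_image X x0"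
    proof
      fix A assume "A \<in> kernel (Hinf_group X x0) (Hinf_group (cone X) (cone_pt x0 t)) lift_class"
      then obtain f where f: "f \<in> based_maps X x0" "A = hclass X x0 f"
          "lift_class (hclass X x0 f) = \<one>\<^bsub>Hinf_group (cone X) (cone_pt x0 t)\<^esub>"
        by (auto simp: kernel_def Hinf_group_simps(1))
      obtain g where g: "g \<in> based_maps X x0" "finite_support x0 g" "hhom X x0 f g"
        using finite_support_if_lift_null[OF f(1)] f(3) k[OF f(1)] by blast
      then show "A \<in> wprod_image X x0"
        unfolding wprod_image_eq[OF x0] f(2) using hclass_eq_iff[OF f(1) g(1)] by blast
    qed
    show "wprod_image X x0 \<subseteq> kernel (Hinf_group X x0) (Hinf_group (cone X) (cone_pt x0 t)) lift_class"
      unfolding wprod_image_eq[OF x0]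
    proof (rule image_subsetI)
      fix f assume "f \<in> {f \<in> based_maps X x0. finite_support x0 f}"
      then have f: "f \<in> based_maps X x0" "finite_support x0 f" by auto
      have "hclass X x0 f \<in> carrier (Hinf_group X x0)" using f(1) by (simp add: Hinf_group_simps)
      then show "hclass X x0 f \<in> kernel (Hinf_group X x0) (Hinf_group (cone X) (cone_pt x0 t)) lift_class"
        using k[OF f(1)] lift_null_if_finite_support[OF f] by (simp add: kernel_def)
    qed
  qed
qed

end

theorem theorem3p7:
  fixes X :: "'a topology" and x0 :: 'a and t :: real
  assumes "x0 \<in> topspace X" and "0 \<le> t" and "t < 1"
  shows "wprod_image X x0 \<lhd> Hinf_group X x0
       \<and> Hinf_group (cone X) (cone_pt x0 t) \<cong> Hinf_group X x0 Mod wprod_image X x0"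
proof -
  note h = lift_class_group_hom[OF assms] and k = kernel_lift_class[OF assms]
  have n: "wprod_image X x0 \<lhd> Hinf_group X x0"
    using group_hom.normal_kernel[OF h] by (simp only: k)
  have "Hinf_group X x0 Mod wprod_image X x0 \<cong> Hinf_group (cone X) (cone_pt x0 t)"
    using group_hom.FactGroup_iso[OF h lift_class_surj[OF assms]] by (simp only: k)
  then have "Hinf_group (cone X) (cone_pt x0 t) \<cong> Hinf_group X x0 Mod wprod_image X x0"
    by (rule group.iso_sym[OF normal.factorgroup_is_group[OF n]])
  with n show ?thesis by blast
qed

end
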